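(* Let $u$ be an inner function on the open unit disk with $u(0)\neq 0$, and let $V_u:\mathcal{K}_u^{\perp}\to L^2$ be the invertible operator $V_uf=P^{-}f+\frac{\overline{u}}{\overline{u(0)}}P^{+}f$, whose inverse is $V_u^{-1}:L^2\to\mathcal{K}_u^{\perp}$, $V_u^{-1}g=P^{-}g+u\,\overline{u(0)}\,P^{+}g$. Then $V_uD_uV_u^{-1}=M$ on $L^2$, where $Mf=zf$. Consequently, for any inner functions $u$ and $v$ with $u(0)\neq0$ and $v(0)\neq0$, $D_u$ is similar to $D_v$, and $D_u=W^{-1}D_vW$, where $W:\mathcal{K}_u^{\perp}\to\mathcal{K}_v^{\perp}$ is given by $Wf=P^{-}f+\frac{\overline{v(0)}}{\overline{u(0)}}\,v\,P^{+}(\overline{u}f)$.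
   Context: $L^2=L^2(\mathbb{T},dm)$, where $\mathbb{T}$ is the unit circle and $m$ is normalized Lebesgue measure. $H^2=\{f\in L^2:\widehat f(n)=0\ \forall n<0\}$ is the Hardy space and $\overline{H^2_0}=\{\overline{zf}:f\in H^2\}$, so $L^2=H^2\oplus\overline{H^2_0}$; $P^{+}$ and $P^{-}$ are the orthogonal projections of $L^2$ onto $H^2$ and $\overline{H^2_0}$ respectively. For an inner function $u$, $\mathcal{K}_u=H^2\cap(uH^2)^{\perp}$, $P_u$ is the orthogonal projection of $L^2$ onto $\mathcal{K}_u$, and $\mathcal{K}_u^{\perp}=\overline{H^2_0}\oplus uH^2$ is the orthogonal complement of $\mathcal{K}_u$ in $L^2$. The dual of the compressed shift is $D_u:\mathcal{K}_u^{\perp}\to\mathcal{K}_u^{\perp}$, $D_uf=(I-P_u)(zf)$. *)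

theory Defs
  imports "HOL-Analysis.Analysis"
begin

section \<open>The space \<open>L\<^sup>2\<close> of the unit circle\<close>

definition circle :: "complex measure" where
  "circle = distr (uniform_measure lborel {0..2 * pi}) (restrict_space borel (sphere 0 1)) cis"

lemma space_circle: "space circle = sphere 0 1"
  by (simp add: circle_def space_restrict_space)

lemma sets_circle: "sets circle = sets (restrict_space borel (sphere 0 1))"
  by (simp add: circle_def)

lemma emeasure_circle_space: "emeasure circle (space circle) = 1"
proof -
  have "cis \<in> borel_measurable borel"
    by (intro borel_measurable_continuous_onI continuous_intros)
  then have m: "cis \<in> measurable (uniform_measure lborel {0..2 * pi}) (restrict_space borel (sphere 0 1))"
    by (intro measurable_restrict_space2) auto
  have "sphere 0 1 \<in> sets (restrict_space borel (sphere (0::complex) 1))"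
    by (metis sets.top space_circle sets_circle)
  with m have "emeasure circle (space circle) =
      emeasure (uniform_measure lborel {0..2 * pi}) UNIV"
    unfolding space_circle unfolding circle_def
    by (subst emeasure_distr) (auto simp: vimage_def)
  also have "\<dots> = 1"
    by (simp add: emeasure_uniform_measure divide_ennreal)
  finally show ?thesis .
qed

definition L2_fun :: "(complex \<Rightarrow> complex) \<Rightarrow> bool" where
  "L2_fun f \<longleftrightarrow> f \<in> borel_measurable circle \<and> integrable circle (\<lambda>\<zeta>. (cmod (f \<zeta>))\<^sup>2)"

definition L2_rel :: "(complex \<Rightarrow> complex) \<Rightarrow> (complex \<Rightarrow> complex) \<Rightarrow> bool" where
  "L2_rel f g \<longleftrightarrow> L2_fun f \<and> L2_fun g \<and> (AE \<zeta> in circle. f \<zeta> = g \<zeta>)"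

lemma L2_fun_zero: "L2_fun (\<lambda>_. 0)"
  by (simp add: L2_fun_def)

lemma L2_fun_scale: "L2_fun f \<Longrightarrow> L2_fun (\<lambda>\<zeta>. c * f \<zeta>)"
  by (auto simp: L2_fun_def norm_mult power_mult_distrib)

lemma L2_fun_add:
  assumes "L2_fun f" "L2_fun g"
  shows "L2_fun (\<lambda>\<zeta>. f \<zeta> + g \<zeta>)"
proof -
  have [measurable]: "f \<in> borel_measurable circle" "g \<in> borel_measurable circle"
    and i: "integrable circle (\<lambda>\<zeta>. 2 * (cmod (f \<zeta>))\<^sup>2 + 2 * (cmod (g \<zeta>))\<^sup>2)"
    using assms by (auto simp: L2_fun_def)
  have b: "(cmod (a + b))\<^sup>2 \<le> 2 * (cmod a)\<^sup>2 + 2 * (cmod b)\<^sup>2" for a b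
  proof -
    have "(cmod (a + b))\<^sup>2 \<le> (cmod a + cmod b)\<^sup>2"
      by (intro power_mono norm_triangle_ineq) auto
    also have "\<dots> \<le> 2 * (cmod a)\<^sup>2 + 2 * (cmod b)\<^sup>2"
      using sum_squares_bound[of "cmod a" "cmod b"] by (simp add: power2_sum)
    finally show ?thesis .
  qed
  have "integrable circle (\<lambda>\<zeta>. (cmod (f \<zeta> + g \<zeta>))\<^sup>2)"
    by (rule Bochner_Integration.integrable_bound[OF i]) (use b in auto)
  then show ?thesis
    by (simp add: L2_fun_def)
qed

lemma L2_fun_diff:
  assumes "L2_fun f" "L2_fun g"
  shows "L2_fun (\<lambda>\<zeta>. f \<zeta> - g \<zeta>)"
  using L2_fun_add[OF assms(1) L2_fun_scale[OF assms(2), of "-1"]] by simp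

lemma L2_fun_cnj: "L2_fun f \<Longrightarrow> L2_fun (\<lambda>\<zeta>. cnj (f \<zeta>))"
  by (auto simp: L2_fun_def intro!: borel_measurable_continuous_on[of cnj] continuous_intros)

lemma L2_fun_prod_integrable:
  assumes "L2_fun f" "L2_fun g"
  shows "integrable circle (\<lambda>\<zeta>. f \<zeta> * cnj (g \<zeta>))"
proof -
  have [measurable]: "f \<in> borel_measurable circle" "(\<lambda>\<zeta>. cnj (g \<zeta>)) \<in> borel_measurable circle"
    and i: "integrable circle (\<lambda>\<zeta>. (cmod (f \<zeta>))\<^sup>2 + (cmod (g \<zeta>))\<^sup>2)"
    using assms L2_fun_cnj[OF assms(2)] by (auto simp: L2_fun_def)
  have b: "cmod a * cmod b \<le> (cmod a)\<^sup>2 + (cmod b)\<^sup>2" for a b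
    using sum_squares_bound[of "cmod a" "cmod b"]
      mult_nonneg_nonneg[OF norm_ge_zero[of a] norm_ge_zero[of b]]
    unfolding mult.assoc by linarith
  show ?thesis
    by (rule Bochner_Integration.integrable_bound[OF i])
       (use b in \<open>auto simp: norm_mult intro!: AE_I2\<close>)
qed

quotient_type L2 = "complex \<Rightarrow> complex" / partial: L2_rel
  morphisms rep_L2 abs_L2
proof (rule part_equivpI)
  show "\<exists>f. L2_rel f f"
    using L2_fun_zero by (auto simp: L2_rel_def)
  show "symp L2_rel"
    by (auto simp: L2_rel_def symp_def)
  show "transp L2_rel"
    unfolding L2_rel_def transp_def by (auto elim: eventually_elim2)
qed

instantiation L2 :: ab_group_add
begin

lift_definition zero_L2 :: L2 is "\<lambda>_. 0"
  by (simp add: L2_rel_def L2_fun_zero)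

lift_definition plus_L2 :: "L2 \<Rightarrow> L2 \<Rightarrow> L2" is "\<lambda>f g \<zeta>. f \<zeta> + g \<zeta>"
  by (auto simp: L2_rel_def L2_fun_add elim: eventually_elim2)

lift_definition minus_L2 :: "L2 \<Rightarrow> L2 \<Rightarrow> L2" is "\<lambda>f g \<zeta>. f \<zeta> - g \<zeta>"
  by (auto simp: L2_rel_def L2_fun_diff elim: eventually_elim2)

lift_definition uminus_L2 :: "L2 \<Rightarrow> L2" is "\<lambda>f \<zeta>. - f \<zeta>"
  using L2_fun_scale[of _ "-1"] by (auto simp: L2_rel_def elim: eventually_mono)

instance
proof
  fix a b c :: L2
  show "a + b + c = a + (b + c)"
    by transfer (auto simp: L2_rel_def L2_fun_add add.assoc)
  show "a + b = b + a"
    by transfer (auto simp: L2_rel_def L2_fun_add add.commute)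
  show "0 + a = a"
    by transfer (auto simp: L2_rel_def)
  show "- a + a = 0"
    using L2_fun_zero by transfer (auto simp: L2_rel_def)
  show "a - b = a + - b"
    by transfer (auto simp: L2_rel_def L2_fun_diff)
qed

end

lift_definition scaleC :: "complex \<Rightarrow> L2 \<Rightarrow> L2" (infixr "*\<^sub>C" 75) is "\<lambda>c f \<zeta>. c * f \<zeta>"
  by (auto simp: L2_rel_def L2_fun_scale elim: eventually_mono)

lift_definition cinner :: "L2 \<Rightarrow> L2 \<Rightarrow> complex" is "\<lambda>f g. LINT \<zeta>|circle. f \<zeta> * cnj (g \<zeta>)"
proof -
  fix f f' g g'
  assume fg: "L2_rel f f'" "L2_rel g g'"
  then have [measurable]: "(\<lambda>\<zeta>. f \<zeta> * cnj (g \<zeta>)) \<in> borel_measurable circle"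
      "(\<lambda>\<zeta>. f' \<zeta> * cnj (g' \<zeta>)) \<in> borel_measurable circle"
    using L2_fun_prod_integrable by (auto simp: L2_rel_def)
  show "(LINT \<zeta>|circle. f \<zeta> * cnj (g \<zeta>)) = (LINT \<zeta>|circle. f' \<zeta> * cnj (g' \<zeta>))"
    by (rule integral_cong_AE) (use fg in \<open>auto simp: L2_rel_def elim: eventually_elim2\<close>)
qed

instantiation L2 :: real_vector
begin

definition scaleR_L2 :: "real \<Rightarrow> L2 \<Rightarrow> L2" where
  "scaleR_L2 r f = complex_of_real r *\<^sub>C f"

instance
proof
  fix x y :: L2 and a b :: real
  show "a *\<^sub>R (x + y) = a *\<^sub>R x + a *\<^sub>R y" unfolding scaleR_L2_def
    by transfer (auto simp: L2_rel_def distrib_left intro!: L2_fun_scale L2_fun_add)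
  show "(a + b) *\<^sub>R x = a *\<^sub>R x + b *\<^sub>R x" unfolding scaleR_L2_def
    by transfer (auto simp: L2_rel_def distrib_right intro!: L2_fun_add L2_fun_scale)
  show "a *\<^sub>R b *\<^sub>R x = (a * b) *\<^sub>R x" unfolding scaleR_L2_def
    by transfer (auto simp: L2_rel_def L2_fun_scale mult.assoc intro!: L2_fun_scale)
  show "1 *\<^sub>R x = x" unfolding scaleR_L2_def
    by transfer (auto simp: L2_rel_def)
qed

end

instantiation L2 :: real_inner
begin

definition inner_L2 :: "L2 \<Rightarrow> L2 \<Rightarrow> real" where
  "inner_L2 f g = Re (cinner f g)"

definition norm_L2 :: "L2 \<Rightarrow> real" where
  "norm_L2 f = sqrt (inner f f)"

definition sgn_L2 :: "L2 \<Rightarrow> L2" where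
  "sgn_L2 f = f /\<^sub>R norm f"

definition dist_L2 :: "L2 \<Rightarrow> L2 \<Rightarrow> real" where
  "dist_L2 f g = norm (f - g)"

definition uniformity_L2 :: "(L2 \<times> L2) filter" where
  "uniformity_L2 = (INF e\<in>{0<..}. principal {(x, y). dist x y < e})"

definition open_L2 :: "L2 set \<Rightarrow> bool" where
  "open_L2 U = (\<forall>x\<in>U. eventually (\<lambda>(x', y). x' = x \<longrightarrow> y \<in> U) uniformity)"

instance
proof
  fix x y z :: L2 and r :: real
  show "inner x y = inner y x" unfolding inner_L2_def
  proof transfer
    fix f g :: "complex \<Rightarrow> complex"
    have "(LINT \<zeta>|circle. g \<zeta> * cnj (f \<zeta>)) = (LINT \<zeta>|circle. cnj (f \<zeta> * cnj (g \<zeta>)))"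
      by (intro Bochner_Integration.integral_cong) (simp_all add: mult.commute)
    also have "\<dots> = cnj (LINT \<zeta>|circle. f \<zeta> * cnj (g \<zeta>))"
      by (rule Bochner_Integration.integral_cnj)
    finally show "Re (LINT \<zeta>|circle. f \<zeta> * cnj (g \<zeta>)) = Re (LINT \<zeta>|circle. g \<zeta> * cnj (f \<zeta>))"
      by simp
  qed
  show "inner (x + y) z = inner x z + inner y z" unfolding inner_L2_def
    by transfer (auto simp: L2_rel_def L2_fun_prod_integrable distrib_right)
  show "inner (r *\<^sub>R x) y = r * inner x y" unfolding inner_L2_def scaleR_L2_def
    by transfer (auto simp: mult.assoc)
  have sq: "z * cnj z = complex_of_real ((cmod z)\<^sup>2)" for z
    by (rule complex_norm_square[symmetric])
  show "0 \<le> inner x x" unfolding inner_L2_def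
    by transfer (simp only: sq integral_complex_of_real Re_complex_of_real, simp)
  show "inner x x = 0 \<longleftrightarrow> x = 0" unfolding inner_L2_def
  proof transfer
    fix f assume f: "L2_rel f f"
    then have "integrable circle (\<lambda>\<zeta>. (cmod (f \<zeta>))\<^sup>2)"
      by (auto simp: L2_rel_def L2_fun_def)
    from integral_nonneg_eq_0_iff_AE[OF this]
    show "Re (LINT \<zeta>|circle. f \<zeta> * cnj (f \<zeta>)) = 0 \<longleftrightarrow> L2_rel f (\<lambda>_. 0)"
      using f L2_fun_zero
      by (simp only: sq integral_complex_of_real Re_complex_of_real) (auto simp: L2_rel_def)
  qed
qed (rule norm_L2_def sgn_L2_def dist_L2_def uniformity_L2_def open_L2_def)+

end

lift_definition conj_L2 :: "L2 \<Rightarrow> L2" is "\<lambda>f \<zeta>. cnj (f \<zeta>)"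
  by (auto simp: L2_rel_def L2_fun_cnj elim: eventually_mono)

text \<open>Multiplication by a function on the circle; meaningful when \<open>\<phi>\<close> is measurable and
  essentially bounded, since \<^const>\<open>abs_L2\<close> is unspecified outside \<^const>\<open>L2_fun\<close>.\<close>

definition mult_L2 :: "(complex \<Rightarrow> complex) \<Rightarrow> L2 \<Rightarrow> L2" where
  "mult_L2 \<phi> f = abs_L2 (\<lambda>\<zeta>. \<phi> \<zeta> * rep_L2 f \<zeta>)"

definition M_z :: "L2 \<Rightarrow> L2" where
  "M_z = mult_L2 (\<lambda>\<zeta>. \<zeta>)"

lift_definition fourier_coeff :: "L2 \<Rightarrow> int \<Rightarrow> complex"
  is "\<lambda>f n. LINT \<zeta>|circle. f \<zeta> * cnj (\<zeta> powi n)"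
proof (rule ext)
  fix f f' :: "complex \<Rightarrow> complex" and n :: int
  assume fg: "L2_rel f f'"
  have "continuous_on (sphere 0 1) (\<lambda>\<zeta>::complex. \<zeta> powi n)"
    by (intro continuous_intros) auto
  then have "(\<lambda>\<zeta>::complex. \<zeta> powi n) \<in> borel_measurable (restrict_space borel (sphere 0 1))"
    by (rule borel_measurable_continuous_on_restrict)
  then have p: "(\<lambda>\<zeta>. \<zeta> powi n) \<in> borel_measurable circle"
    by (simp add: measurable_cong_sets[OF sets_circle refl])
  have [measurable]: "(\<lambda>\<zeta>. cnj (\<zeta> powi n)) \<in> borel_measurable circle"
    by (rule borel_measurable_continuous_on[OF _ p, of cnj]) (intro continuous_intros)
  have [measurable]: "f \<in> borel_measurable circle" "f' \<in> borel_measurable circle"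
    using fg by (auto simp: L2_rel_def L2_fun_def)
  show "(LINT \<zeta>|circle. f \<zeta> * cnj (\<zeta> powi n)) = (LINT \<zeta>|circle. f' \<zeta> * cnj (\<zeta> powi n))"
  proof (rule integral_cong_AE)
    show "AE \<zeta> in circle. f \<zeta> * cnj (\<zeta> powi n) = f' \<zeta> * cnj (\<zeta> powi n)"
      using fg by (auto simp: L2_rel_def elim: eventually_mono)
  qed measurable
qed

section \<open>Subspaces and operators\<close>

definition orth_compl :: "L2 set \<Rightarrow> L2 set" where
  "orth_compl S = {f. \<forall>g\<in>S. cinner f g = 0}"

definition orth_proj :: "L2 set \<Rightarrow> L2 \<Rightarrow> L2" where
  "orth_proj S f = (THE g. g \<in> S \<and> f - g \<in> orth_compl S)"

text \<open>Operators between subspaces are functions on the whole of \<^typ>\<open>L2\<close>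
  of which only the values on the domain \<open>S\<close> matter.\<close>

definition bounded_op :: "L2 set \<Rightarrow> L2 set \<Rightarrow> (L2 \<Rightarrow> L2) \<Rightarrow> bool" where
  "bounded_op S T A \<longleftrightarrow>
     (\<forall>f\<in>S. A f \<in> T) \<and>
     (\<forall>f\<in>S. \<forall>g\<in>S. A (f + g) = A f + A g) \<and>
     (\<forall>c. \<forall>f\<in>S. A (c *\<^sub>C f) = c *\<^sub>C A f) \<and>
     (\<exists>C. \<forall>f\<in>S. norm (A f) \<le> C * norm f)"

definition is_inverse_op :: "L2 set \<Rightarrow> L2 set \<Rightarrow> (L2 \<Rightarrow> L2) \<Rightarrow> (L2 \<Rightarrow> L2) \<Rightarrow> bool" where
  "is_inverse_op S T A B \<longleftrightarrow>
     bounded_op S T A \<and> bounded_op T S B \<and> (\<forall>f\<in>S. B (A f) = f) \<and> (\<forall>g\<in>T. A (B g) = g)"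

definition invertible_op :: "L2 set \<Rightarrow> L2 set \<Rightarrow> (L2 \<Rightarrow> L2) \<Rightarrow> bool" where
  "invertible_op S T A \<longleftrightarrow> (\<exists>B. is_inverse_op S T A B)"

definition similar_op :: "L2 set \<Rightarrow> (L2 \<Rightarrow> L2) \<Rightarrow> L2 set \<Rightarrow> (L2 \<Rightarrow> L2) \<Rightarrow> bool" where
  "similar_op S A T B \<longleftrightarrow> bounded_op S S A \<and> bounded_op T T B \<and>
     (\<exists>X. invertible_op S T X \<and> (\<forall>f\<in>S. A f = inv_into S X (B (X f))))"

section \<open>Hardy space, inner functions and the dual of the compressed shift\<close>

definition H2 :: "L2 set" where
  "H2 = {f. \<forall>n<0. fourier_coeff f n = 0}"

definition H2_0_conj :: "L2 set" where
  "H2_0_conj = (\<lambda>f. conj_L2 (M_z f)) ` H2"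

definition P_plus :: "L2 \<Rightarrow> L2" where "P_plus = orth_proj H2"

definition P_minus :: "L2 \<Rightarrow> L2" where "P_minus = orth_proj H2_0_conj"

text \<open>An inner function is a bounded holomorphic function on the disk having a radial limit of
  modulus 1 at almost every point of the circle. \<open>boundary u\<close> is its boundary function; in
  products with elements of \<open>L\<^sup>2\<close> the inner function is identified with it.\<close>

definition inner_function :: "(complex \<Rightarrow> complex) \<Rightarrow> bool" where
  "inner_function u \<longleftrightarrow> u holomorphic_on ball 0 1 \<and> bounded (u ` ball 0 1) \<and>
     (AE \<zeta> in circle. \<exists>l. cmod l = 1 \<and> ((\<lambda>r. u (complex_of_real r * \<zeta>)) \<longlongrightarrow> l) (at_left 1))"

definition boundary :: "(complex \<Rightarrow> complex) \<Rightarrow> complex \<Rightarrow> complex" where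
  "boundary u \<zeta> = Lim (at_left 1) (\<lambda>r. u (complex_of_real r * \<zeta>))"

definition K_model :: "(complex \<Rightarrow> complex) \<Rightarrow> L2 set" where
  "K_model u = H2 \<inter> orth_compl (mult_L2 (boundary u) ` H2)"

definition P_model :: "(complex \<Rightarrow> complex) \<Rightarrow> L2 \<Rightarrow> L2" where
  "P_model u = orth_proj (K_model u)"

definition K_perp :: "(complex \<Rightarrow> complex) \<Rightarrow> L2 set" where
  "K_perp u = orth_compl (K_model u)"

definition D_dual :: "(complex \<Rightarrow> complex) \<Rightarrow> L2 \<Rightarrow> L2" where
  "D_dual u f = M_z f - P_model u (M_z f)"

definition V_op :: "(complex \<Rightarrow> complex) \<Rightarrow> L2 \<Rightarrow> L2" where
  "V_op u f = P_minus f + mult_L2 (\<lambda>\<zeta>. cnj (boundary u \<zeta>) / cnj (u 0)) (P_plus f)"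

definition V_inv :: "(complex \<Rightarrow> complex) \<Rightarrow> L2 \<Rightarrow> L2" where
  "V_inv u g = P_minus g + mult_L2 (\<lambda>\<zeta>. boundary u \<zeta> * cnj (u 0)) (P_plus g)"

definition W_op :: "(complex \<Rightarrow> complex) \<Rightarrow> (complex \<Rightarrow> complex) \<Rightarrow> L2 \<Rightarrow> L2" where
  "W_op u v f = P_minus f + (cnj (v 0) / cnj (u 0)) *\<^sub>C
     mult_L2 (boundary v) (P_plus (mult_L2 (\<lambda>\<zeta>. cnj (boundary u \<zeta>)) f))"

end

theory Submission
  imports
    Defs
    "HOL-Complex_Analysis.Cauchy_Integral_Formula"
    "HOL-Real_Asymp.Real_Asymp"
begin

text \<open>Multiplication by \<open>u\<close> is an isometry of \<open>L\<^sup>2\<close> that preserves \<open>H\<^sup>2\<close>, so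
  \<open>P\<^sub>u = P\<^sup>+ - u P\<^sup>+ cnj u P\<^sup>+\<close>, and every \<open>f\<close> in the orthogonal complement of
  \<open>K\<^sub>u\<close> is \<open>g + u h\<close> with \<open>g\<close> in the conjugate of \<open>H\<^sup>2\<^sub>0\<close> and \<open>h\<close> in \<open>H\<^sup>2\<close>.
  Multiplication by \<open>z\<close> moves \<open>f\<close> out of this complement only through the constant term \<open>c\<close> of
  \<open>z g\<close>. Since \<open>P\<^sub>u 1 = 1 - cnj (u 0) u\<close>, the operator \<open>D\<^sub>u\<close> replaces \<open>c\<close> by
  \<open>c cnj (u 0) u\<close>, which \<open>V\<^sub>u\<close> turns back into \<open>c\<close>. Hence \<open>V\<^sub>u D\<^sub>u = M V\<^sub>u\<close>,
  and \<open>W\<close> is the restriction of \<open>V\<^sub>v\<inverse> V\<^sub>u\<close>.\<close>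

section \<open>Integration on the circle\<close>

text \<open>The definitions leave two gaps. \<open>orth_proj\<close> is a definite description, so
  each projection has to be exhibited together with a decomposition before it can be used; and
  \<open>H2\<close> is given by Fourier coefficients, whereas inner functions are given by radial
  limits. The first gap is closed by summing Fourier series over nonnegative frequencies.
  Completeness of \<open>L2\<close> makes these series converge, and uniqueness of Fourier
  coefficients shows that an element of \<open>H2\<close> is its own series, hence orthogonal to
  \<open>H2_0_conj\<close>. The second gap is closed by the power series of u on circles of radius
  below 1: letting the radius tend to 1 shows that the boundary function has only nonnegative
  frequencies and mean u(0). This mean is the origin of the constant in V, since the part of the
  conjugate of u in \<open>H2\<close> is the conjugate of u(0). A further obstacle is that
  \<open>mult_L2\<close> is meaningful only when the product is in L2, so \<open>boundary u\<close>,
  including its default value where no limit exists, must first be shown measurable.\<close>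

lemma finite_measure_circle: "finite_measure circle"
  by (rule finite_measureI) (simp add: emeasure_circle_space)

interpretation circle: finite_measure circle
  by (rule finite_measure_circle)

lemma measure_circle_space [simp]: "measure circle (space circle) = 1"
  by (simp add: measure_def emeasure_circle_space)

lemma circle_measurableI:
  assumes "continuous_on (sphere 0 1) f"
  shows "f \<in> borel_measurable circle"
  using borel_measurable_continuous_on_restrict[OF assms]
  by (simp add: measurable_cong_sets[OF sets_circle refl])

lemma powi_measurable_circle [measurable]: "(\<lambda>\<zeta>. \<zeta> powi n) \<in> borel_measurable circle"
  by (rule circle_measurableI) (auto intro!: continuous_intros)

lemma id_measurable_circle [measurable]: "(\<lambda>\<zeta>. \<zeta>) \<in> borel_measurable circle"
  by (rule circle_measurableI) (auto intro!: continuous_intros)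

lemma cnj_measurable [measurable]: "cnj \<in> borel_measurable borel"
  by (intro borel_measurable_continuous_onI continuous_intros)

lemma AE_circle_norm_eq_1: "AE \<zeta> in circle. cmod \<zeta> = 1"
  by (rule AE_I2) (simp add: space_circle)

lemma cnj_eq_inverse_circle: "\<zeta> \<in> space circle \<Longrightarrow> cnj \<zeta> = inverse \<zeta>"
  using complex_norm_square[of \<zeta>]
  by (auto simp: inverse_eq_divide eq_divide_eq mult.commute space_circle)

lemma cis_measurable_circle:
  "cis \<in> measurable (uniform_measure lborel {0..2 * pi}) (restrict_space borel (sphere 0 1))"
proof -
  have "cis \<in> borel_measurable borel"
    by (intro borel_measurable_continuous_onI continuous_intros)
  then show ?thesis
    by (intro measurable_restrict_space2) auto
qed

lemma integral_circle:
  fixes f :: "complex \<Rightarrow> complex"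
  assumes "f \<in> borel_measurable circle"
  shows "(LINT \<zeta>|circle. f \<zeta>) =
    (LINT t|lborel. (indicator {0..2 * pi} t / (2 * pi)) *\<^sub>R f (cis t))"
proof -
  have f: "f \<in> borel_measurable (restrict_space borel (sphere 0 1))"
    using assms by (simp add: measurable_cong_sets[OF sets_circle refl])
  have m: "cis \<in> measurable lborel (restrict_space borel (sphere 0 1))"
    using cis_measurable_circle by (simp add: measurable_def)
  have [measurable]: "(\<lambda>t. f (cis t)) \<in> borel_measurable borel"
    using measurable_compose[OF m f] by simp
  have u: "uniform_measure lborel {0..2 * pi} =
      density lborel (\<lambda>t. ennreal (indicator {0..2 * pi} t / (2 * pi)))"
    unfolding uniform_measure_def
    by (intro density_cong) (auto simp: divide_ennreal indicator_def ennreal_1[symmetric] simp del: ennreal_1)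
  have "(LINT \<zeta>|circle. f \<zeta>) = (LINT t|uniform_measure lborel {0..2 * pi}. f (cis t))"
    unfolding circle_def by (rule integral_distr[OF cis_measurable_circle f])
  also have "\<dots> = (LINT t|lborel. (indicator {0..2 * pi} t / (2 * pi)) *\<^sub>R f (cis t))"
    unfolding u by (rule integral_density) auto
  finally show ?thesis .
qed

lemma integral_circle_powi:
  "(LINT \<zeta>|circle. \<zeta> powi n) = (if n = 0 then 1 else 0)"
proof (cases "n = 0")
  case True
  then show ?thesis by simp
next
  case False
  \<comment> \<open>An antiderivative of \<open>cis (n * t)\<close>, available because n is nonzero;
    by periodicity its increment over a full turn vanishes.\<close>
  define F where "F t = cis (of_int n * t) / (\<i> * of_int n)" for t :: real
  have eq: "(indicator {0..2 * pi} t / (2 * pi)) *\<^sub>R (cis t powi n) =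
      (1 / (2 * pi)) *\<^sub>R (indicator {0..2 * pi} t *\<^sub>R cis (of_int n * t))" for t
    by (simp add: cis_power_int)
  have "(F has_vector_derivative cis (of_int n * t)) (at t within {0..2 * pi})" for t
  proof -
    have "((\<lambda>z. exp (\<i> * (of_int n * z)) / (\<i> * of_int n))
        has_field_derivative exp (\<i> * (of_int n * of_real t))) (at (of_real t))"
      using False by (auto intro!: derivative_eq_intros simp: algebra_simps)
    from has_vector_derivative_real_field[OF this] show ?thesis
      by (simp add: F_def[abs_def] cis_conv_exp)
  qed
  then have "(LINT t|lborel. indicator {0..2 * pi} t *\<^sub>R cis (of_int n * t)) = F (2 * pi) - F 0"
    by (intro integral_FTC_Icc) (auto intro!: continuous_intros)
  also have "F (2 * pi) - F 0 = 0"
    using cis_multiple_2pi[of "of_int n"] by (simp add: F_def mult.commute)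
  finally have "(LINT t|lborel. indicator {0..2 * pi} t *\<^sub>R cis (of_int n * t)) = 0" .
  then show ?thesis
    unfolding integral_circle[OF powi_measurable_circle] eq Bochner_Integration.integral_scaleR_right
    using False by (simp only: scaleR_zero_right if_False)
qed

section \<open>Completeness of \<open>L\<^sup>2\<close>\<close>

lemma L2_rel_refl_iff [simp]: "L2_rel f f \<longleftrightarrow> L2_fun f"
  by (simp add: L2_rel_def)

lemma L2_fun_rep_L2: "L2_fun (rep_L2 x)"
  using Quotient3_rep_reflp[OF Quotient3_L2, of x] by simp

lemma abs_rep_L2: "abs_L2 (rep_L2 x) = x"
  by (rule Quotient3_abs_rep[OF Quotient3_L2])

lemma L2_cases [case_names abs, cases type: L2]:
  obtains f where "L2_fun f" "x = abs_L2 f"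
  using L2_fun_rep_L2[of x] abs_rep_L2[of x] by metis

lemma abs_L2_eq_iff:
  assumes "L2_fun f" "L2_fun g"
  shows "abs_L2 f = abs_L2 g \<longleftrightarrow> (AE \<zeta> in circle. f \<zeta> = g \<zeta>)"
  using Quotient3_rel[OF Quotient3_L2, of f g] assms by (auto simp: L2_rel_def)

lemma AE_rep_abs_L2:
  assumes "L2_fun f"
  shows "AE \<zeta> in circle. rep_L2 (abs_L2 f) \<zeta> = f \<zeta>"
  using abs_L2_eq_iff[OF L2_fun_rep_L2[of "abs_L2 f"] assms] by (simp add: abs_rep_L2)

lemma L2_fun_measurable: "L2_fun f \<Longrightarrow> f \<in> borel_measurable circle"
  and L2_fun_square_integrable: "L2_fun f \<Longrightarrow> integrable circle (\<lambda>\<zeta>. (cmod (f \<zeta>))\<^sup>2)"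
  by (auto simp: L2_fun_def)

lemma
  assumes "L2_fun f" "L2_fun g"
  shows abs_L2_add: "abs_L2 f + abs_L2 g = abs_L2 (\<lambda>\<zeta>. f \<zeta> + g \<zeta>)"
    and abs_L2_diff: "abs_L2 f - abs_L2 g = abs_L2 (\<lambda>\<zeta>. f \<zeta> - g \<zeta>)"
    and cinner_abs_L2: "cinner (abs_L2 f) (abs_L2 g) = (LINT \<zeta>|circle. f \<zeta> * cnj (g \<zeta>))"
  using assms by (auto simp: plus_L2.abs_eq minus_L2.abs_eq cinner.abs_eq)

lemma
  assumes "L2_fun f"
  shows abs_L2_scale: "c *\<^sub>C abs_L2 f = abs_L2 (\<lambda>\<zeta>. c * f \<zeta>)"
    and abs_L2_conj: "conj_L2 (abs_L2 f) = abs_L2 (\<lambda>\<zeta>. cnj (f \<zeta>))"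
    and fourier_coeff_abs_L2:
      "fourier_coeff (abs_L2 f) n = (LINT \<zeta>|circle. f \<zeta> * cnj (\<zeta> powi n))"
  using assms by (auto simp: scaleC.abs_eq conj_L2.abs_eq fourier_coeff.abs_eq)

lemma L2_fun_bounded:
  assumes "f \<in> borel_measurable circle" "AE \<zeta> in circle. cmod (f \<zeta>) \<le> C"
  shows "L2_fun f"
proof -
  have "integrable circle (\<lambda>\<zeta>. (cmod (f \<zeta>))\<^sup>2)"
  proof (rule circle.integrable_const_bound[where B = "C\<^sup>2"])
    show "AE \<zeta> in circle. norm ((cmod (f \<zeta>))\<^sup>2) \<le> C\<^sup>2"
      using assms(2) by eventually_elim (simp add: power_mono)
  qed (use assms(1) in measurable)
  with assms(1) show ?thesis by (simp add: L2_fun_def)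
qed

lemma L2_fun_powi: "L2_fun (\<lambda>\<zeta>. \<zeta> powi n)"
  by (rule L2_fun_bounded[where C = 1]) (use AE_circle_norm_eq_1 in \<open>auto simp: norm_power_int\<close>)

lemma L2_fun_integrable:
  assumes "L2_fun f"
  shows "integrable circle f"
  using L2_fun_prod_integrable[OF assms L2_fun_powi[of 0]] by simp

lemma cinner_add_left: "cinner (x + y) z = cinner x z + cinner y z"
  by transfer (auto simp: L2_fun_prod_integrable distrib_right)

lemma cinner_diff_left: "cinner (x - y) z = cinner x z - cinner y z"
  by transfer (auto simp: L2_fun_prod_integrable left_diff_distrib)

lemma cinner_scaleC_left: "cinner (c *\<^sub>C x) z = c * cinner x z"
  by transfer (auto simp: mult.assoc)

lemma cinner_commute: "cinner y x = cnj (cinner x y)"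
proof transfer
  fix f g :: "complex \<Rightarrow> complex"
  have "(LINT \<zeta>|circle. g \<zeta> * cnj (f \<zeta>)) = (LINT \<zeta>|circle. cnj (f \<zeta> * cnj (g \<zeta>)))"
    by (intro Bochner_Integration.integral_cong) (simp_all add: mult.commute)
  then show "(LINT \<zeta>|circle. f \<zeta> * cnj (g \<zeta>)) = cnj (LINT \<zeta>|circle. g \<zeta> * cnj (f \<zeta>))"
    using Bochner_Integration.integral_cnj by (metis complex_cnj_cnj)
qed

lemma cinner_diff_right: "cinner z (x - y) = cinner z x - cinner z y"
  and cinner_scaleC_right: "cinner z (c *\<^sub>C x) = cnj c * cinner z x"
  unfolding cinner_commute[of z]
  by (simp_all add: cinner_diff_left cinner_scaleC_left)

lemma cinner_zero [simp]: "cinner 0 x = 0" "cinner x 0 = 0"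
  using cinner_diff_left[of x x] cinner_diff_right[of _ x x] cinner_diff_left[of 0 0]
  by (metis cancel_comm_monoid_add_class.diff_cancel)+

lemma cinner_self: "cinner x x = of_real ((norm x)\<^sup>2)"
proof -
  have "Im (cinner x x) = 0"
    using cinner_commute[of x x] by (simp add: complex_eq_iff)
  then show ?thesis
    by (simp add: norm_L2_def inner_L2_def complex_eq_iff)
       (metis inner_ge_zero inner_L2_def real_sqrt_pow2)
qed

lemma cinner_self_eq_0_iff [simp]: "cinner x x = 0 \<longleftrightarrow> x = 0"
  by (simp add: cinner_self)

lemma cinner_sum_left: "cinner (sum f A) z = (\<Sum>i\<in>A. cinner (f i) z)"
  by (induction A rule: infinite_finite_induct) (auto simp: cinner_add_left)

lemma norm_scaleC: "norm (c *\<^sub>C x) = cmod c * norm x"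
proof -
  have "complex_of_real ((norm (c *\<^sub>C x))\<^sup>2) = c * cnj c * cinner x x"
    by (simp only: cinner_self[symmetric] cinner_scaleC_left cinner_scaleC_right mult_ac)
  also have "\<dots> = complex_of_real ((cmod c * norm x)\<^sup>2)"
    by (simp only: cinner_self complex_norm_square[symmetric] power_mult_distrib of_real_mult)
  finally show ?thesis
    by (simp only: of_real_eq_iff) (simp add: power2_eq_iff_nonneg)
qed

lemma norm_cinner_le: "cmod (cinner x y) \<le> norm x * norm y"
proof (cases "cinner x y = 0")
  case False
  \<comment> \<open>Rotating x by the unimodular phase c makes the inner product equal to its own
    modulus, so the real Cauchy-Schwarz inequality suffices.\<close>
  define c where "c = cnj (cinner x y) / cmod (cinner x y)"
  have "cinner (c *\<^sub>C x) y = cmod (cinner x y)"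
    using False complex_norm_square[of "cinner x y"]
    by (simp add: c_def cinner_scaleC_left field_simps power2_eq_square)
  then have "cmod (cinner x y) = inner (c *\<^sub>C x) y"
    by (simp add: inner_L2_def)
  also have "\<dots> \<le> norm (c *\<^sub>C x) * norm y"
    by (rule norm_cauchy_schwarz)
  also have "norm (c *\<^sub>C x) = norm x"
    using False by (simp add: norm_scaleC c_def norm_divide)
  finally show ?thesis .
qed auto

lemma norm_abs_L2_square:
  assumes "L2_fun f"
  shows "(norm (abs_L2 f))\<^sup>2 = (LINT \<zeta>|circle. (cmod (f \<zeta>))\<^sup>2)"
proof -
  have "complex_of_real ((norm (abs_L2 f))\<^sup>2) = (LINT \<zeta>|circle. complex_of_real ((cmod (f \<zeta>))\<^sup>2))"
    using assms by (simp only: cinner_self[symmetric] cinner_abs_L2 complex_norm_square)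
  then show ?thesis
    by (simp only: integral_complex_of_real of_real_eq_iff)
qed

lemma ennreal_norm_abs_L2_square:
  assumes "L2_fun f"
  shows "ennreal ((norm (abs_L2 f))\<^sup>2) = (\<integral>\<^sup>+\<zeta>. ennreal ((cmod (f \<zeta>))\<^sup>2) \<partial>circle)"
  using assms by (subst nn_integral_eq_integral) (auto simp: norm_abs_L2_square L2_fun_def)

lemma scaleC_add_right: "c *\<^sub>C (x + y) = c *\<^sub>C x + c *\<^sub>C y"
  by transfer (auto simp: L2_rel_def distrib_left intro!: L2_fun_scale L2_fun_add)

lemma scaleC_diff_right: "c *\<^sub>C (x - y) = c *\<^sub>C x - c *\<^sub>C y"
  by transfer (auto simp: L2_rel_def right_diff_distrib intro!: L2_fun_scale L2_fun_diff)

lemma scaleC_scaleC: "a *\<^sub>C b *\<^sub>C x = (a * b) *\<^sub>C x"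
  by transfer (auto simp: L2_rel_def L2_fun_scale mult.assoc intro!: L2_fun_scale)

lemma scaleC_one [simp]: "1 *\<^sub>C x = x"
  by transfer (auto simp: L2_rel_def)


section \<open>The Riesz-Fischer theorem\<close>

lemma L2_integral_norm_le:
  assumes "L2_fun f"
  shows "(LINT \<zeta>|circle. cmod (f \<zeta>)) \<le> norm (abs_L2 f)"
proof -
  let ?g = "\<lambda>\<zeta>. complex_of_real (cmod (f \<zeta>))"
  have g: "L2_fun ?g"
    using assms by (auto simp: L2_fun_def)
  have one: "L2_fun (\<lambda>_. 1)"
    using L2_fun_powi[of 0] by simp
  have "(norm (abs_L2 (\<lambda>_. 1)))\<^sup>2 = 1"
    by (simp add: norm_abs_L2_square[OF one])
  then have 1: "norm (abs_L2 (\<lambda>_. 1)) = 1"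
    by (simp add: power2_eq_1_iff) (use norm_ge_zero in \<open>metis neg_0_le_iff_le not_one_le_zero\<close>)
  have "(norm (abs_L2 ?g))\<^sup>2 = (norm (abs_L2 f))\<^sup>2"
    by (simp add: norm_abs_L2_square g assms)
  then have n: "norm (abs_L2 ?g) = norm (abs_L2 f)"
    by (simp add: power2_eq_iff_nonneg)
  \<comment> \<open>Cauchy-Schwarz against the constant 1, whose norm is 1 because the circle has
    total mass 1.\<close>
  have "cmod (LINT \<zeta>|circle. ?g \<zeta>) \<le> norm (abs_L2 ?g) * norm (abs_L2 (\<lambda>_. 1))"
    using norm_cinner_le[of "abs_L2 ?g" "abs_L2 (\<lambda>_. 1)"] by (simp add: cinner_abs_L2 g one)
  then show ?thesis
    unfolding 1 n integral_complex_of_real by simp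
qed

text \<open>Consecutive differences have integrated modulus at most \<open>(1 / 2) ^ k\<close>, so
  the sum of their moduli is integrable, hence finite almost everywhere, and the sequence converges
  at almost every point. Fatou's lemma passes the mean-square bound to the limit.\<close>

lemma L2_fast_Cauchy_limit:
  assumes F: "\<And>k. L2_fun (F k)"
    and d: "\<And>k m. k \<le> m \<Longrightarrow> norm (abs_L2 (F m) - abs_L2 (F k)) \<le> (1 / 2) ^ k"
  obtains f where "L2_fun f" "\<And>k. norm (abs_L2 f - abs_L2 (F k)) \<le> (1 / 2) ^ k"
proof -
  note [measurable] = L2_fun_measurable[OF F]
  define g where "g k \<zeta> = cmod (F (Suc k) \<zeta> - F k \<zeta>)" for k \<zeta>
  have [measurable]: "g k \<in> borel_measurable circle" for k
    unfolding g_def[abs_def] by measurable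
  have g_le: "(\<integral>\<^sup>+\<zeta>. ennreal (g k \<zeta>) \<partial>circle) \<le> ennreal ((1 / 2) ^ k)" for k
  proof -
    have "integrable circle (g k)"
      unfolding g_def[abs_def] by (intro integrable_norm L2_fun_integrable L2_fun_diff F)
    then have "(\<integral>\<^sup>+\<zeta>. ennreal (g k \<zeta>) \<partial>circle) = ennreal (LINT \<zeta>|circle. g k \<zeta>)"
      by (rule nn_integral_eq_integral) (simp add: g_def)
    also have "\<dots> \<le> ennreal ((1 / 2) ^ k)"
      using L2_integral_norm_le[OF L2_fun_diff[OF F[of "Suc k"] F[of k]]] d[of k "Suc k"]
      by (intro ennreal_leI) (simp add: g_def abs_L2_diff F)
    finally show ?thesis .
  qed
  have "(\<integral>\<^sup>+\<zeta>. (\<Sum>k. ennreal (g k \<zeta>)) \<partial>circle) = (\<Sum>k. \<integral>\<^sup>+\<zeta>. ennreal (g k \<zeta>) \<partial>circle)"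
    by (rule nn_integral_suminf) measurable
  also have "\<dots> \<le> (\<Sum>k. ennreal ((1 / 2) ^ k))"
    by (intro suminf_le g_le) auto
  also have "\<dots> < \<infinity>"
    by (subst suminf_ennreal2) (auto intro: summable_geometric)
  finally have "AE \<zeta> in circle. (\<Sum>k. ennreal (g k \<zeta>)) \<noteq> \<infinity>"
    by (intro nn_integral_PInf_AE) auto
  then have conv: "AE \<zeta> in circle. (\<lambda>k. F k \<zeta>) \<longlonglongrightarrow> lim (\<lambda>k. F k \<zeta>)"
  proof eventually_elim
    case (elim \<zeta>)
    then have "summable (\<lambda>k. norm (F (Suc k) \<zeta> - F k \<zeta>))"
      unfolding g_def by (intro summable_suminf_not_top) auto
    then have "summable (\<lambda>k. F (Suc k) \<zeta> - F k \<zeta>)"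
      by (rule summable_norm_cancel)
    then have "convergent (\<lambda>n. F n \<zeta> - F 0 \<zeta>)"
      by (simp add: summable_iff_convergent sum_lessThan_telescope[of "\<lambda>i. F i \<zeta>"])
    then have "convergent (\<lambda>n. F n \<zeta>)"
      using convergent_diff_const_right_iff by blast
    then show ?case
      by (simp add: convergent_LIMSEQ_iff)
  qed
  \<comment> \<open>Where the sequence diverges, \<open>lim\<close> yields one fixed unspecified
    value; this keeps f measurable and concerns only a null set.\<close>
  define f where "f \<zeta> = lim (\<lambda>k. F k \<zeta>)" for \<zeta>
  have [measurable]: "f \<in> borel_measurable circle"
    unfolding f_def[abs_def] by measurable
  have le: "(\<integral>\<^sup>+\<zeta>. ennreal ((cmod (f \<zeta> - F k \<zeta>))\<^sup>2) \<partial>circle) \<le> ennreal (((1 / 2) ^ k)\<^sup>2)" for k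
  proof -
    have "(\<integral>\<^sup>+\<zeta>. ennreal ((cmod (f \<zeta> - F k \<zeta>))\<^sup>2) \<partial>circle) =
        (\<integral>\<^sup>+\<zeta>. liminf (\<lambda>m. ennreal ((cmod (F m \<zeta> - F k \<zeta>))\<^sup>2)) \<partial>circle)"
    proof (rule nn_integral_cong_AE)
      show "AE \<zeta> in circle. ennreal ((cmod (f \<zeta> - F k \<zeta>))\<^sup>2) =
          liminf (\<lambda>m. ennreal ((cmod (F m \<zeta> - F k \<zeta>))\<^sup>2))"
        using conv
      proof eventually_elim
        case (elim \<zeta>)
        have "(\<lambda>m. ennreal ((cmod (F m \<zeta> - F k \<zeta>))\<^sup>2)) \<longlonglongrightarrow> ennreal ((cmod (f \<zeta> - F k \<zeta>))\<^sup>2)"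
          by (intro tendsto_intros) (use elim in \<open>simp add: f_def\<close>)
        from lim_imp_Liminf[OF trivial_limit_sequentially this] show ?case
          by simp
      qed
    qed
    also have "\<dots> \<le> liminf (\<lambda>m. \<integral>\<^sup>+\<zeta>. ennreal ((cmod (F m \<zeta> - F k \<zeta>))\<^sup>2) \<partial>circle)"
      by (rule nn_integral_liminf) measurable
    also have "\<dots> \<le> ennreal (((1 / 2) ^ k)\<^sup>2)"
    proof (rule Liminf_le)
      show "eventually (\<lambda>m. (\<integral>\<^sup>+\<zeta>. ennreal ((cmod (F m \<zeta> - F k \<zeta>))\<^sup>2) \<partial>circle)
          \<le> ennreal (((1 / 2) ^ k)\<^sup>2)) sequentially"
        using eventually_ge_at_top[of k]
      proof eventually_elim
        case (elim m)
        then show ?case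
          using d[OF elim] by (auto simp: ennreal_norm_abs_L2_square[symmetric] L2_fun_diff F
              abs_L2_diff[symmetric] intro!: ennreal_leI power_mono)
      qed
    qed simp
    finally show ?thesis .
  qed
  have diff: "L2_fun (\<lambda>\<zeta>. f \<zeta> - F k \<zeta>)" for k
  proof -
    have "integrable circle (\<lambda>\<zeta>. (cmod (f \<zeta> - F k \<zeta>))\<^sup>2)"
      by (rule integrableI_bounded) (use le[of k] in \<open>auto simp: less_top[symmetric] top_unique\<close>)
    then show ?thesis
      by (simp add: L2_fun_def)
  qed
  have "L2_fun f"
    using L2_fun_add[OF diff F, of 0 0] by simp
  moreover have "norm (abs_L2 f - abs_L2 (F k)) \<le> (1 / 2) ^ k" for k
  proof -
    have "ennreal ((norm (abs_L2 f - abs_L2 (F k)))\<^sup>2) \<le> ennreal (((1 / 2) ^ k)\<^sup>2)"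
      using le[of k] by (simp add: abs_L2_diff \<open>L2_fun f\<close> F ennreal_norm_abs_L2_square[OF diff])
    then show ?thesis
      by (subst (asm) ennreal_le_iff) (auto intro: power2_le_imp_le)
  qed
  ultimately show ?thesis
    using that by blast
qed

instance L2 :: banach
proof
  fix X :: "nat \<Rightarrow> L2"
  assume X: "Cauchy X"
  have "\<exists>N. \<forall>m\<ge>N. \<forall>n\<ge>N. dist (X m) (X n) < (1 / 2) ^ k" for k
    using X by (simp add: Cauchy_def)
  then obtain N where N: "\<And>k m n. N k \<le> m \<Longrightarrow> N k \<le> n \<Longrightarrow> dist (X m) (X n) < (1 / 2) ^ k"
    by metis
  \<comment> \<open>Summing the thresholds makes \<open>r m\<close> dominate \<open>N k\<close> for
    every k up to m, so later members of the subsequence can be compared with earlier ones.\<close>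
  define r where "r k = (\<Sum>i\<le>k. N i)" for k
  have r: "N k \<le> r m" if "k \<le> m" for k m
    unfolding r_def using that by (intro member_le_sum) auto
  obtain f where f: "L2_fun f"
    "\<And>k. norm (abs_L2 f - abs_L2 (rep_L2 (X (r k)))) \<le> (1 / 2) ^ k"
  proof (rule L2_fast_Cauchy_limit[of "\<lambda>k. rep_L2 (X (r k))"])
    show "norm (abs_L2 (rep_L2 (X (r m))) - abs_L2 (rep_L2 (X (r k)))) \<le> (1 / 2) ^ k"
      if "k \<le> m" for k m
      using N[OF r[OF that] r[OF order_refl]] by (simp add: abs_rep_L2 dist_norm less_imp_le)
  qed (auto simp: L2_fun_rep_L2)
  have "X \<longlonglongrightarrow> abs_L2 f"
  proof (rule metric_LIMSEQ_I)
    fix e :: real assume "e > 0"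
    then obtain k where k: "(1 / 2) ^ k < e / 2"
      using real_arch_pow_inv[of "e / 2" "1 / 2"] by auto
    have "dist (X n) (abs_L2 f) < e" if "n \<ge> N k" for n
    proof -
      have "dist (X n) (abs_L2 f) \<le> dist (X n) (X (r k)) + dist (abs_L2 f) (X (r k))"
        by (rule dist_triangle2)
      also have "\<dots> < e"
        using N[OF that r[OF order_refl]] f(2)[of k] k by (simp add: dist_norm abs_rep_L2)
      finally show ?thesis .
    qed
    then show "\<exists>no. \<forall>n\<ge>no. dist (X n) (abs_L2 f) < e"
      by blast
  qed
  then show "convergent X"
    by (auto simp: convergent_def)
qed

section \<open>Uniqueness of Fourier coefficients\<close>

text \<open>Demanding all integer powers makes the property stable under multiplication by
  \<open>\<zeta>\<close> and \<open>1/\<zeta>\<close>, so it passes to products with real polynomials by induction; Stone--Weierstrass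
  and a Dynkin argument then extend it to continuous functions and to indicators.\<close>

definition annihilates_powers :: "(complex \<Rightarrow> complex) \<Rightarrow> bool" where
  "annihilates_powers g \<longleftrightarrow>
     integrable circle g \<and> (\<forall>n::int. (LINT \<zeta>|circle. g \<zeta> * \<zeta> powi n) = 0)"

lemma integrable_circle_mult_bounded:
  fixes g \<phi> :: "complex \<Rightarrow> complex"
  assumes g: "integrable circle g" and m: "\<phi> \<in> borel_measurable circle"
    and b: "\<And>\<zeta>. cmod \<zeta> = 1 \<Longrightarrow> cmod (\<phi> \<zeta>) \<le> C"
  shows "integrable circle (\<lambda>\<zeta>. g \<zeta> * \<phi> \<zeta>)"
proof (rule Bochner_Integration.integrable_bound)
  show "integrable circle (\<lambda>\<zeta>. C * cmod (g \<zeta>))"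
    using g by (intro integrable_mult_right integrable_norm)
  have [measurable]: "g \<in> borel_measurable circle"
    using g by auto
  show "(\<lambda>\<zeta>. g \<zeta> * \<phi> \<zeta>) \<in> borel_measurable circle"
    using m by measurable
  show "AE \<zeta> in circle. cmod (g \<zeta> * \<phi> \<zeta>) \<le> norm (C * cmod (g \<zeta>))"
  proof (rule AE_I2)
    fix \<zeta> assume "\<zeta> \<in> space circle"
    then have "cmod (\<phi> \<zeta>) \<le> C"
      by (intro b) (simp add: space_circle)
    then have "cmod (\<phi> \<zeta>) * cmod (g \<zeta>) \<le> \<bar>C\<bar> * cmod (g \<zeta>)"
      by (intro mult_right_mono) auto
    then show "cmod (g \<zeta> * \<phi> \<zeta>) \<le> norm (C * cmod (g \<zeta>))"
      by (simp add: norm_mult abs_mult mult.commute)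
  qed
qed

lemma integrable_circle_mult_powi:
  "integrable circle g \<Longrightarrow> integrable circle (\<lambda>\<zeta>. g \<zeta> * \<zeta> powi n)"
  by (rule integrable_circle_mult_bounded[where C = 1]) (auto simp: norm_power_int)

lemma annihilates_powers_add:
  assumes "annihilates_powers f" "annihilates_powers g"
  shows "annihilates_powers (\<lambda>\<zeta>. f \<zeta> + g \<zeta>)"
  using assms by (auto simp: annihilates_powers_def distrib_right integrable_circle_mult_powi)

lemma annihilates_powers_mult_right:
  "annihilates_powers f \<Longrightarrow> annihilates_powers (\<lambda>\<zeta>. f \<zeta> * c)"
proof -
  have "f \<zeta> * c * \<zeta> powi n = f \<zeta> * \<zeta> powi n * c" for \<zeta> n
    by simp
  then show "annihilates_powers f \<Longrightarrow> annihilates_powers (\<lambda>\<zeta>. f \<zeta> * c)"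
    by (simp only: annihilates_powers_def integral_mult_left_zero integrable_mult_left) simp
qed

lemma annihilates_powers_cong:
  assumes "annihilates_powers f" "\<And>\<zeta>. cmod \<zeta> = 1 \<Longrightarrow> f \<zeta> = g \<zeta>"
  shows "annihilates_powers g"
proof -
  have "integrable circle g"
    using assms by (subst Bochner_Integration.integrable_cong[of circle circle g f])
      (auto simp: annihilates_powers_def space_circle)
  moreover have "(LINT \<zeta>|circle. g \<zeta> * \<zeta> powi n) = (LINT \<zeta>|circle. f \<zeta> * \<zeta> powi n)" for n
    using assms by (intro Bochner_Integration.integral_cong) (auto simp: space_circle)
  ultimately show ?thesis
    using assms(1) by (simp add: annihilates_powers_def)
qed

lemma annihilates_powers_mult_powi:
  assumes "annihilates_powers f"
  shows "annihilates_powers (\<lambda>\<zeta>. f \<zeta> * \<zeta> powi m)"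
proof -
  have "(LINT \<zeta>|circle. f \<zeta> * \<zeta> powi m * \<zeta> powi n) = (LINT \<zeta>|circle. f \<zeta> * \<zeta> powi (m + n))" for n
  proof (intro Bochner_Integration.integral_cong refl)
    fix \<zeta> assume "\<zeta> \<in> space circle"
    then have "\<zeta> \<noteq> 0" by (auto simp: space_circle)
    then show "f \<zeta> * \<zeta> powi m * \<zeta> powi n = f \<zeta> * \<zeta> powi (m + n)"
      by (simp add: power_int_add)
  qed
  then show ?thesis
    using assms by (simp add: annihilates_powers_def integrable_circle_mult_powi)
qed

text \<open>The induction keeps g arbitrary because in the product case the first factor is absorbed
  into g before the second one is treated.\<close>

lemma annihilates_powers_mult_polynomial:
  assumes "real_polynomial_function p" "annihilates_powers g"
  shows "annihilates_powers (\<lambda>\<zeta>. g \<zeta> * of_real (p \<zeta>))"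
  using assms
proof (induction p arbitrary: g rule: real_polynomial_function.induct)
  case (linear f)
  note g = linear.prems
  interpret bounded_linear f by fact
  \<comment> \<open>Chosen so that \<open>f \<zeta>\<close> is twice the real part of
    \<open>a * \<zeta>\<close>; on the circle the conjugate of \<open>\<zeta>\<close> is a power,
    namely its inverse.\<close>
  define a where "a = Complex (f 1 / 2) (- f \<i> / 2)"
  have "annihilates_powers (\<lambda>\<zeta>. g \<zeta> * \<zeta> powi 1 * a + g \<zeta> * \<zeta> powi (-1) * cnj a)"
    using g by (intro annihilates_powers_add annihilates_powers_mult_right annihilates_powers_mult_powi)
  then show ?case
  proof (rule annihilates_powers_cong)
    fix \<zeta> :: complex assume "cmod \<zeta> = 1"
    then have inv: "inverse \<zeta> = cnj \<zeta>"
      by (simp add: cnj_eq_inverse_circle space_circle)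
    have "f \<zeta> = f (Re \<zeta> *\<^sub>R 1 + Im \<zeta> *\<^sub>R \<i>)"
      by (rule arg_cong[where f = f]) (simp add: complex_eq_iff)
    also have "\<dots> = Re \<zeta> * f 1 + Im \<zeta> * f \<i>"
      by (simp only: add scaleR real_scaleR_def)
    finally have "complex_of_real (f \<zeta>) = \<zeta> * a + cnj \<zeta> * cnj a"
      by (simp add: a_def complex_eq_iff)
    then show "g \<zeta> * \<zeta> powi 1 * a + g \<zeta> * \<zeta> powi (-1) * cnj a = g \<zeta> * of_real (f \<zeta>)"
      by (simp add: inv power_int_minus distrib_left mult.assoc)
  qed
next
  case (add f1 f2)
  then show ?case
    by (simp add: distrib_left annihilates_powers_add)
next
  case (mult f1 f2)
  from mult.IH(2)[OF mult.IH(1)[OF mult.prems]] show ?case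
    by (simp add: mult.assoc)
qed (rule annihilates_powers_mult_right)

lemma annihilates_powers_continuous:
  fixes \<phi> :: "complex \<Rightarrow> real"
  assumes g: "annihilates_powers g" and \<phi>: "continuous_on (sphere 0 1) \<phi>"
  shows "(LINT \<zeta>|circle. g \<zeta> * of_real (\<phi> \<zeta>)) = 0"
proof -
  have gi: "integrable circle g"
    using g by (simp add: annihilates_powers_def)
  obtain B where "\<forall>\<zeta>\<in>sphere 0 1. \<bar>\<phi> \<zeta>\<bar> \<le> B"
    using compact_imp_bounded[OF compact_continuous_image[OF \<phi> compact_sphere]]
    by (auto simp: bounded_iff)
  then have B: "\<And>\<zeta>. cmod \<zeta> = 1 \<Longrightarrow> \<bar>\<phi> \<zeta>\<bar> \<le> B"
    by simp
  have \<phi>m: "(\<lambda>\<zeta>. complex_of_real (\<phi> \<zeta>)) \<in> borel_measurable circle"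
    using \<phi> by (intro circle_measurableI continuous_intros)
  have \<phi>i: "integrable circle (\<lambda>\<zeta>. g \<zeta> * of_real (\<phi> \<zeta>))"
    by (rule integrable_circle_mult_bounded[OF gi \<phi>m, of B]) (use B in auto)
  define I where "I = (LINT \<zeta>|circle. cmod (g \<zeta>))"
  have "cmod (LINT \<zeta>|circle. g \<zeta> * of_real (\<phi> \<zeta>)) \<le> e * I" if e: "e > 0" for e
  proof -
    obtain p where p: "real_polynomial_function p" "\<And>\<zeta>. cmod \<zeta> = 1 \<Longrightarrow> \<bar>\<phi> \<zeta> - p \<zeta>\<bar> < e"
      using Stone_Weierstrass_real_polynomial_function[OF compact_sphere \<phi> e]
      by (metis mem_sphere_0)
    have "annihilates_powers (\<lambda>\<zeta>. g \<zeta> * of_real (p \<zeta>))"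
      using p(1) g by (rule annihilates_powers_mult_polynomial)
    then have pi: "integrable circle (\<lambda>\<zeta>. g \<zeta> * of_real (p \<zeta>))"
      and p0: "(LINT \<zeta>|circle. g \<zeta> * of_real (p \<zeta>)) = 0"
      by (auto simp: annihilates_powers_def dest: spec[of _ 0])
    have "(LINT \<zeta>|circle. g \<zeta> * of_real (\<phi> \<zeta>)) =
        (LINT \<zeta>|circle. g \<zeta> * of_real (\<phi> \<zeta>) - g \<zeta> * of_real (p \<zeta>))"
      using \<phi>i pi p0 by simp
    also have "cmod \<dots> \<le> (LINT \<zeta>|circle. cmod (g \<zeta> * of_real (\<phi> \<zeta>) - g \<zeta> * of_real (p \<zeta>)))"
      by (rule integral_norm_bound)
    also have "\<dots> \<le> (LINT \<zeta>|circle. e * cmod (g \<zeta>))"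
    proof (rule integral_mono)
      fix \<zeta> assume "\<zeta> \<in> space circle"
      then have "\<bar>\<phi> \<zeta> - p \<zeta>\<bar> \<le> e"
        using p(2)[of \<zeta>] by (simp add: space_circle)
      then show "cmod (g \<zeta> * of_real (\<phi> \<zeta>) - g \<zeta> * of_real (p \<zeta>)) \<le> e * cmod (g \<zeta>)"
        by (simp add: right_diff_distrib[symmetric] of_real_diff[symmetric] norm_mult
            mult.commute[of e] mult_left_mono del: of_real_diff)
    qed (use gi \<phi>i pi in \<open>auto intro!: integrable_norm\<close>)
    finally show ?thesis
      by (simp add: I_def)
  qed
  then have "cmod (LINT \<zeta>|circle. g \<zeta> * of_real (\<phi> \<zeta>)) \<le> 0 + e" if "e > 0" for e
  proof -
    have "I \<ge> 0" by (simp add: I_def)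
    \<comment> \<open>Dividing by \<open>I + 1\<close> rather than by \<open>I\<close> also covers
      the case \<open>I = 0\<close>.\<close>
    have "e / (I + 1) * I \<le> e"
      using \<open>I \<ge> 0\<close> that by (simp add: field_simps)
    moreover have "e / (I + 1) > 0"
      using \<open>I \<ge> 0\<close> that by simp
    ultimately show ?thesis
      using \<open>\<And>e. e > 0 \<Longrightarrow> cmod (LINT \<zeta>|circle. g \<zeta> * of_real (\<phi> \<zeta>)) \<le> e * I\<close> by force
  qed
  then have "cmod (LINT \<zeta>|circle. g \<zeta> * of_real (\<phi> \<zeta>)) \<le> 0"
    by (rule field_le_epsilon)
  then show ?thesis
    by simp
qed

lemma annihilates_powers_closed:
  assumes g: "annihilates_powers g" and C: "closed C"
  shows "(LINT \<zeta>|circle. g \<zeta> * indicator C \<zeta>) = 0"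
proof (cases "C = {}")
  case False
  have gi: "integrable circle g"
    using g by (simp add: annihilates_powers_def)
  then have [measurable]: "g \<in> borel_measurable circle"
    by auto
  \<comment> \<open>Continuous cut-offs that equal 1 on C and vanish at distance at least 1/n from
    it. They tend to the indicator because C is closed; the empty set was split off since
    \<open>infdist\<close> to it is 0 by convention.\<close>
  define \<phi> where "\<phi> n \<zeta> = max 0 (1 - real n * infdist \<zeta> C)" for n \<zeta>
  have cont: "continuous_on (sphere 0 1) (\<phi> n)" for n
    unfolding \<phi>_def by (intro continuous_intros)
  have [measurable]: "\<phi> n \<in> borel_measurable circle" for n
    by (rule circle_measurableI[OF cont])
  have b: "0 \<le> \<phi> n \<zeta>" "\<phi> n \<zeta> \<le> 1" for n \<zeta>
    by (auto simp: \<phi>_def infdist_nonneg)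
  have "(\<lambda>n. LINT \<zeta>|circle. g \<zeta> * of_real (\<phi> n \<zeta>)) \<longlonglongrightarrow>
      (LINT \<zeta>|circle. g \<zeta> * indicator C \<zeta>)"
  proof (rule integral_dominated_convergence[where w = "\<lambda>\<zeta>. cmod (g \<zeta>)"])
    have "(\<lambda>n. \<phi> n \<zeta>) \<longlonglongrightarrow> indicator C \<zeta>" for \<zeta>
    proof (cases "\<zeta> \<in> C")
      case True
      then show ?thesis by (simp add: \<phi>_def)
    next
      case False
      then have "infdist \<zeta> C > 0"
        using C \<open>C \<noteq> {}\<close> in_closed_iff_infdist_zero infdist_nonneg by (metis less_eq_real_def)
      then obtain N where N: "1 < real N * infdist \<zeta> C"
        using reals_Archimedean3 by blast
      have "\<phi> n \<zeta> = 0" if "n \<ge> N" for n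
      proof -
        have "real N * infdist \<zeta> C \<le> real n * infdist \<zeta> C"
          using that by (intro mult_right_mono) (auto simp: infdist_nonneg)
        with N show ?thesis by (simp add: \<phi>_def)
      qed
      then have "eventually (\<lambda>n. \<phi> n \<zeta> = 0) sequentially"
        by (auto simp: eventually_sequentially)
      with False show ?thesis
        by (auto intro: tendsto_eventually)
    qed
    then have "(\<lambda>n. g \<zeta> * complex_of_real (\<phi> n \<zeta>)) \<longlonglongrightarrow> g \<zeta> * complex_of_real (indicator C \<zeta>)" for \<zeta>
      by (intro tendsto_intros)
    then show "AE \<zeta> in circle. (\<lambda>n. g \<zeta> * of_real (\<phi> n \<zeta>)) \<longlonglongrightarrow> g \<zeta> * indicator C \<zeta>"
      by (simp add: of_real_indicator)
    show "AE \<zeta> in circle. norm (g \<zeta> * of_real (\<phi> n \<zeta>)) \<le> cmod (g \<zeta>)" for n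
      using b[of n] by (intro AE_I2) (auto simp: norm_mult intro!: mult_left_le)
    have "(\<lambda>\<zeta>. indicator C \<zeta> :: complex) \<in> borel_measurable circle"
      unfolding measurable_cong_sets[OF sets_circle refl]
      using C by (intro measurable_restrict_space1) (auto intro: borel_closed)
    then show "(\<lambda>\<zeta>. g \<zeta> * indicator C \<zeta>) \<in> borel_measurable circle"
      by measurable
  qed (use gi in auto)
  moreover have "(LINT \<zeta>|circle. g \<zeta> * of_real (\<phi> n \<zeta>)) = 0" for n
    by (rule annihilates_powers_continuous[OF g cont])
  ultimately show ?thesis
    by (simp add: LIMSEQ_const_iff)
qed simp

text \<open>The measurable sets of the circle are traces of planar Borel sets, so the Dynkin
  argument runs over closed sets of the plane, which are stable under intersection, and cuts down to
  the circle only in the domain of integration.\<close>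

lemma annihilates_powers_set_integral:
  assumes g: "annihilates_powers g" and A: "A \<in> sets circle"
  shows "(LINT \<zeta>:A|circle. g \<zeta>) = 0"
proof -
  have gi: "integrable circle g"
    using g by (simp add: annihilates_powers_def)
  have S: "B \<inter> sphere 0 1 \<in> sets circle" if "B \<in> sets borel" for B
    using that by (auto simp: sets_circle sets_restrict_space)
  have si: "set_integrable circle B g" if "B \<in> sets circle" for B
    using gi that by (rule integrable_mult_indicator[folded set_integrable_def, rotated])
  have closed: "(LINT \<zeta>:C \<inter> sphere 0 1|circle. g \<zeta>) = 0" if "closed C" for C
  proof -
    have "(LINT \<zeta>:C \<inter> sphere 0 1|circle. g \<zeta>) = (LINT \<zeta>|circle. g \<zeta> * indicator C \<zeta>)"
      unfolding set_lebesgue_integral_def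
      by (intro Bochner_Integration.integral_cong) (auto simp: space_circle indicator_def)
    then show ?thesis
      using annihilates_powers_closed[OF g that] by simp
  qed
  obtain B where B: "A = B \<inter> sphere 0 1" "B \<in> sets borel"
    using A by (auto simp: sets_circle sets_restrict_space)
  have b: "sigma_sets UNIV (Collect closed) = sets (borel :: complex measure)"
    by (simp add: borel_eq_closed)
  have "Int_stable (Collect closed :: complex set set)"
    by (auto simp: Int_stable_def)
  moreover have "Collect closed \<subseteq> Pow (UNIV :: complex set)"
    by simp
  moreover have "B \<in> sigma_sets UNIV (Collect closed)"
    using B by (simp add: b)
  ultimately have "(LINT \<zeta>:B \<inter> sphere 0 1|circle. g \<zeta>) = 0"
  proof (induction B rule: sigma_sets_induct_disjoint)
    case (compl B)
    have "(LINT \<zeta>:(UNIV \<inter> sphere 0 1)|circle. g \<zeta>) =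
        (LINT \<zeta>:(B \<inter> sphere 0 1) \<union> ((UNIV - B) \<inter> sphere 0 1)|circle. g \<zeta>)"
      by (rule arg_cong[where f = "\<lambda>A. LINT \<zeta>:A|circle. g \<zeta>"]) auto
    also have "\<dots> = (LINT \<zeta>:(B \<inter> sphere 0 1)|circle. g \<zeta>) + (LINT \<zeta>:((UNIV - B) \<inter> sphere 0 1)|circle. g \<zeta>)"
      using compl(1) unfolding b by (intro set_integral_Un si S) auto
    \<comment> \<open>The integral over the whole circle vanishes by the closed case of the entire
      plane.\<close>
    finally show ?case
      using compl(2) closed[of UNIV] by simp
  next
    case (union B)
    have m: "B i \<inter> sphere 0 1 \<in> sets circle" for i
      using union(2) unfolding b by (intro S) auto
    have "(LINT \<zeta>:(\<Union>i. B i \<inter> sphere 0 1)|circle. g \<zeta>) = (\<Sum>i. LINT \<zeta>:(B i \<inter> sphere 0 1)|circle. g \<zeta>)"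
    proof (rule lebesgue_integral_countable_add)
      show "set_integrable circle (\<Union>i. B i \<inter> sphere 0 1) g"
        using m by (intro si sets.countable_UN) auto
    qed (use m union(1) in \<open>auto simp: disjoint_family_on_def\<close>)
    also have "\<dots> = 0"
      using union(3) by simp
    finally show ?case
      by (simp add: Int_UN_distrib2)
  qed (use closed closed[of "{}"] in auto)
  with B show ?thesis by simp
qed

text \<open>Test with the set where f is positive: the restricted integrand is nonnegative with
  integral zero, so it vanishes almost everywhere.\<close>

lemma AE_le_0_if_set_integrals_0:
  fixes f :: "'a \<Rightarrow> real"
  assumes "integrable M f" "\<And>A. A \<in> sets M \<Longrightarrow> (LINT x:A|M. f x) = 0"
  shows "AE x in M. f x \<le> 0"
proof -
  have [measurable]: "f \<in> borel_measurable M"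
    using assms by auto
  let ?A = "{x \<in> space M. 0 < f x}"
  have i: "integrable M (\<lambda>x. indicator ?A x *\<^sub>R f x)"
    using assms(1) by (intro integrable_mult_indicator) auto
  have "(LINT x|M. indicator ?A x *\<^sub>R f x) = 0"
    using assms(2)[of ?A] by (simp add: set_lebesgue_integral_def)
  then have "AE x in M. indicator ?A x *\<^sub>R f x = 0"
    by (subst (asm) integral_nonneg_eq_0_iff_AE[OF i]) (auto simp: indicator_def)
  then show ?thesis
    using AE_space by eventually_elim (auto simp: indicator_def split: if_splits)
qed

lemma AE_eq_0_if_set_integrals_0:
  fixes f :: "'a \<Rightarrow> real"
  assumes "integrable M f" "\<And>A. A \<in> sets M \<Longrightarrow> (LINT x:A|M. f x) = 0"
  shows "AE x in M. f x = 0"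
proof -
  have "AE x in M. f x \<le> 0"
    using assms by (rule AE_le_0_if_set_integrals_0)
  moreover have "AE x in M. - f x \<le> 0"
    using assms by (intro AE_le_0_if_set_integrals_0) (auto simp: set_lebesgue_integral_def)
  ultimately show ?thesis
    by eventually_elim auto
qed

lemma annihilates_powers_AE_zero:
  assumes "annihilates_powers g"
  shows "AE \<zeta> in circle. g \<zeta> = 0"
proof -
  have gi: "integrable circle g"
    using assms by (simp add: annihilates_powers_def)
  have i: "integrable circle (\<lambda>\<zeta>. indicator A \<zeta> *\<^sub>R g \<zeta>)" if "A \<in> sets circle" for A
    using gi that by (intro integrable_mult_indicator)
  have z: "(LINT \<zeta>|circle. indicator A \<zeta> *\<^sub>R g \<zeta>) = 0" if "A \<in> sets circle" for A
    using annihilates_powers_set_integral[OF assms that] by (simp add: set_lebesgue_integral_def)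
  have "AE \<zeta> in circle. Re (g \<zeta>) = 0"
  proof (rule AE_eq_0_if_set_integrals_0)
    show "(LINT \<zeta>:A|circle. Re (g \<zeta>)) = 0" if "A \<in> sets circle" for A
      using integral_Re[OF i[OF that]] z[OF that] by (simp add: set_lebesgue_integral_def)
  qed (use gi in auto)
  moreover have "AE \<zeta> in circle. Im (g \<zeta>) = 0"
  proof (rule AE_eq_0_if_set_integrals_0)
    show "(LINT \<zeta>:A|circle. Im (g \<zeta>)) = 0" if "A \<in> sets circle" for A
      using integral_Im[OF i[OF that]] z[OF that] by (simp add: set_lebesgue_integral_def)
  qed (use gi in auto)
  ultimately show ?thesis
    by eventually_elim (simp add: complex_eq_iff)
qed

lemma fourier_coeff_eq_0_imp:
  assumes "\<And>n. fourier_coeff f n = 0"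
  shows "f = 0"
proof (cases f)
  case (abs g)
  have "(LINT \<zeta>|circle. g \<zeta> * \<zeta> powi n) = 0" for n
  proof -
    have "(LINT \<zeta>|circle. g \<zeta> * \<zeta> powi n) = (LINT \<zeta>|circle. g \<zeta> * cnj (\<zeta> powi (-n)))"
    proof (intro Bochner_Integration.integral_cong refl)
      fix \<zeta> assume "\<zeta> \<in> space circle"
      then have "cnj \<zeta> = inverse \<zeta>"
        by (rule cnj_eq_inverse_circle)
      then show "g \<zeta> * \<zeta> powi n = g \<zeta> * cnj (\<zeta> powi (-n))"
        by (simp add: power_int_minus power_int_inverse)
    qed
    also have "\<dots> = 0"
      using assms[of "-n"] by (simp add: abs fourier_coeff_abs_L2)
    finally show ?thesis .
  qed
  then have "annihilates_powers g"
    using L2_fun_integrable[OF abs(1)] by (simp add: annihilates_powers_def)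
  then show ?thesis
    using abs_L2_eq_iff[OF abs(1) L2_fun_zero] abs(2)
    by (simp add: annihilates_powers_AE_zero zero_L2_def)
qed

section \<open>Multiplication operators\<close>

text \<open>A class of multipliers that keep products in L2, so that \<open>mult_L2\<close> is
  meaningful for them. The bound is only almost everywhere because the modulus of a boundary
  function is controlled only there.\<close>

definition ess_bounded :: "(complex \<Rightarrow> complex) \<Rightarrow> bool" where
  "ess_bounded \<phi> \<longleftrightarrow>
     \<phi> \<in> borel_measurable circle \<and> (\<exists>C. AE \<zeta> in circle. cmod (\<phi> \<zeta>) \<le> C)"

lemma ess_bounded_const [simp, intro]: "ess_bounded (\<lambda>_. c)"
  by (auto simp: ess_bounded_def)

lemma ess_bounded_id [simp, intro]: "ess_bounded (\<lambda>\<zeta>. \<zeta>)"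
  using AE_circle_norm_eq_1
  by (auto simp: ess_bounded_def elim: eventually_mono intro!: exI[of _ 1])

lemma ess_bounded_mult [intro]:
  assumes "ess_bounded \<phi>" "ess_bounded \<psi>"
  shows "ess_bounded (\<lambda>\<zeta>. \<phi> \<zeta> * \<psi> \<zeta>)"
proof -
  obtain C D where "AE \<zeta> in circle. cmod (\<phi> \<zeta>) \<le> C" "AE \<zeta> in circle. cmod (\<psi> \<zeta>) \<le> D"
    using assms by (auto simp: ess_bounded_def)
  then have "AE \<zeta> in circle. cmod (\<phi> \<zeta> * \<psi> \<zeta>) \<le> \<bar>C\<bar> * \<bar>D\<bar>"
    by eventually_elim (auto simp: norm_mult intro!: mult_mono)
  then show ?thesis
    using assms by (auto simp: ess_bounded_def)
qed

lemma ess_bounded_cnj [intro]: "ess_bounded \<phi> \<Longrightarrow> ess_bounded (\<lambda>\<zeta>. cnj (\<phi> \<zeta>))"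
  by (auto simp: ess_bounded_def intro!: measurable_compose[OF _ cnj_measurable])

lemma L2_fun_mult:
  assumes "ess_bounded \<phi>" "L2_fun f"
  shows "L2_fun (\<lambda>\<zeta>. \<phi> \<zeta> * f \<zeta>)"
proof -
  obtain C where C: "AE \<zeta> in circle. cmod (\<phi> \<zeta>) \<le> C"
    using assms by (auto simp: ess_bounded_def)
  have [measurable]: "\<phi> \<in> borel_measurable circle" "f \<in> borel_measurable circle"
    using assms by (auto simp: ess_bounded_def L2_fun_def)
  have "integrable circle (\<lambda>\<zeta>. (cmod (\<phi> \<zeta> * f \<zeta>))\<^sup>2)"
  proof (rule Bochner_Integration.integrable_bound)
    show "integrable circle (\<lambda>\<zeta>. C\<^sup>2 * (cmod (f \<zeta>))\<^sup>2)"
      using assms(2) by (auto simp: L2_fun_def)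
    show "AE \<zeta> in circle. norm ((cmod (\<phi> \<zeta> * f \<zeta>))\<^sup>2) \<le> norm (C\<^sup>2 * (cmod (f \<zeta>))\<^sup>2)"
      using C by eventually_elim
        (auto simp: norm_mult power_mult_distrib intro!: mult_right_mono power_mono)
  qed measurable
  then show ?thesis by (simp add: L2_fun_def)
qed

text \<open>\<open>mult_L2\<close> works on the chosen representative; being free to use any other
  one reduces the algebra of multipliers to pointwise identities.\<close>

lemma mult_L2_abs_L2:
  assumes "ess_bounded \<phi>" "L2_fun f"
  shows "mult_L2 \<phi> (abs_L2 f) = abs_L2 (\<lambda>\<zeta>. \<phi> \<zeta> * f \<zeta>)"
  unfolding mult_L2_def
  by (subst abs_L2_eq_iff)
    (use AE_rep_abs_L2[OF assms(2)] assms in \<open>auto intro: L2_fun_mult L2_fun_rep_L2 elim: eventually_mono\<close>)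

lemma mult_L2_add: "ess_bounded \<phi> \<Longrightarrow> mult_L2 \<phi> (f + g) = mult_L2 \<phi> f + mult_L2 \<phi> g"
  by (cases f; cases g)
    (simp add: mult_L2_abs_L2 abs_L2_add L2_fun_mult L2_fun_add distrib_left)

lemma mult_L2_diff: "ess_bounded \<phi> \<Longrightarrow> mult_L2 \<phi> (f - g) = mult_L2 \<phi> f - mult_L2 \<phi> g"
  by (cases f; cases g)
    (simp add: mult_L2_abs_L2 abs_L2_diff L2_fun_mult L2_fun_diff right_diff_distrib)

lemma mult_L2_scaleC: "ess_bounded \<phi> \<Longrightarrow> mult_L2 \<phi> (c *\<^sub>C f) = c *\<^sub>C mult_L2 \<phi> f"
  by (cases f) (simp add: mult_L2_abs_L2 abs_L2_scale L2_fun_mult L2_fun_scale mult.left_commute)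

lemma mult_L2_mult_L2:
  "ess_bounded \<phi> \<Longrightarrow> ess_bounded \<psi> \<Longrightarrow> mult_L2 \<phi> (mult_L2 \<psi> f) = mult_L2 (\<lambda>\<zeta>. \<phi> \<zeta> * \<psi> \<zeta>) f"
  by (cases f) (simp add: mult_L2_abs_L2 L2_fun_mult ess_bounded_mult mult.assoc)

lemma mult_L2_const: "mult_L2 (\<lambda>_. c) f = c *\<^sub>C f"
  by (cases f) (simp add: mult_L2_abs_L2 abs_L2_scale)

lemma mult_L2_cong_AE:
  assumes "ess_bounded \<phi>" "ess_bounded \<psi>" "AE \<zeta> in circle. \<phi> \<zeta> = \<psi> \<zeta>"
  shows "mult_L2 \<phi> f = mult_L2 \<psi> f"
proof (cases f)
  case (abs g)
  have "AE \<zeta> in circle. \<phi> \<zeta> * g \<zeta> = \<psi> \<zeta> * g \<zeta>"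
    using assms(3) by eventually_elim simp
  then show ?thesis
    using assms abs by (simp add: mult_L2_abs_L2 abs_L2_eq_iff L2_fun_mult)
qed

lemma cinner_mult_L2_left:
  "ess_bounded \<phi> \<Longrightarrow> cinner (mult_L2 \<phi> f) g = cinner f (mult_L2 (\<lambda>\<zeta>. cnj (\<phi> \<zeta>)) g)"
  by (cases f; cases g)
    (simp add: mult_L2_abs_L2 cinner_abs_L2 L2_fun_mult ess_bounded_cnj, simp add: mult_ac)

lemma norm_mult_L2_bounded:
  assumes "ess_bounded \<phi>"
  obtains C where "C \<ge> 0" "\<And>f. norm (mult_L2 \<phi> f) \<le> C * norm f"
proof -
  obtain C where C: "AE \<zeta> in circle. cmod (\<phi> \<zeta>) \<le> C"
    using assms by (auto simp: ess_bounded_def)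
  have "norm (mult_L2 \<phi> f) \<le> \<bar>C\<bar> * norm f" for f
  proof (cases f)
    case (abs g)
    have "(norm (mult_L2 \<phi> f))\<^sup>2 = (LINT \<zeta>|circle. (cmod (\<phi> \<zeta> * g \<zeta>))\<^sup>2)"
      using assms abs by (simp add: mult_L2_abs_L2 norm_abs_L2_square L2_fun_mult)
    also have "\<dots> \<le> (LINT \<zeta>|circle. C\<^sup>2 * (cmod (g \<zeta>))\<^sup>2)"
    proof (rule integral_mono_AE)
      show "AE \<zeta> in circle. (cmod (\<phi> \<zeta> * g \<zeta>))\<^sup>2 \<le> C\<^sup>2 * (cmod (g \<zeta>))\<^sup>2"
        using C by eventually_elim
          (auto simp: norm_mult power_mult_distrib intro!: mult_right_mono power_mono)
    qed (use L2_fun_square_integrable[OF L2_fun_mult[OF assms abs(1)]]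
          L2_fun_square_integrable[OF abs(1)] in auto)
    also have "\<dots> = (\<bar>C\<bar> * norm f)\<^sup>2"
      using abs by (simp add: norm_abs_L2_square power_mult_distrib)
    finally show ?thesis
      by (rule power2_le_imp_le) simp
  qed
  then show ?thesis
    using that[of "\<bar>C\<bar>"] by simp
qed

section \<open>Fourier coefficients and the Riesz projection\<close>

definition pow_L2 :: "int \<Rightarrow> L2" where
  "pow_L2 n = abs_L2 (\<lambda>\<zeta>. \<zeta> powi n)"

lemma fourier_coeff_eq_cinner: "fourier_coeff f n = cinner f (pow_L2 n)"
  by (cases f) (simp add: fourier_coeff_abs_L2 cinner_abs_L2 pow_L2_def L2_fun_powi)

lemma fourier_coeff_add: "fourier_coeff (f + g) n = fourier_coeff f n + fourier_coeff g n"
  and fourier_coeff_diff: "fourier_coeff (f - g) n = fourier_coeff f n - fourier_coeff g n"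
  and fourier_coeff_scaleC: "fourier_coeff (c *\<^sub>C f) n = c * fourier_coeff f n"
  by (simp_all add: fourier_coeff_eq_cinner cinner_add_left cinner_diff_left cinner_scaleC_left)

lemma fourier_coeff_pow_L2: "fourier_coeff (pow_L2 m) n = (if m = n then 1 else 0)"
proof -
  have "fourier_coeff (pow_L2 m) n = (LINT \<zeta>|circle. \<zeta> powi m * cnj (\<zeta> powi n))"
    by (simp add: fourier_coeff_abs_L2 pow_L2_def L2_fun_powi)
  also have "\<dots> = (LINT \<zeta>|circle. \<zeta> powi (m - n))"
  proof (intro Bochner_Integration.integral_cong refl)
    fix \<zeta> assume \<zeta>: "\<zeta> \<in> space circle"
    then have "\<zeta> \<noteq> 0" by (auto simp: space_circle)
    then show "\<zeta> powi m * cnj (\<zeta> powi n) = \<zeta> powi (m - n)"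
      using cnj_eq_inverse_circle[OF \<zeta>] by (simp add: power_int_diff power_int_inverse divide_inverse)
  qed
  finally show ?thesis
    by (simp add: integral_circle_powi)
qed

lemma cinner_pow_L2: "cinner (pow_L2 m) (pow_L2 n) = (if m = n then 1 else 0)"
  using fourier_coeff_pow_L2 by (simp add: fourier_coeff_eq_cinner)

lemma fourier_coeff_M_z: "fourier_coeff (M_z f) n = fourier_coeff f (n - 1)"
proof (cases f)
  case (abs g)
  have "fourier_coeff (M_z f) n = (LINT \<zeta>|circle. \<zeta> * g \<zeta> * cnj (\<zeta> powi n))"
    using abs by (simp add: M_z_def mult_L2_abs_L2 fourier_coeff_abs_L2 L2_fun_mult)
  also have "\<dots> = (LINT \<zeta>|circle. g \<zeta> * cnj (\<zeta> powi (n - 1)))"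
  proof (intro Bochner_Integration.integral_cong refl)
    fix \<zeta> assume \<zeta>: "\<zeta> \<in> space circle"
    then have "\<zeta> \<noteq> 0" by (auto simp: space_circle)
    then show "\<zeta> * g \<zeta> * cnj (\<zeta> powi n) = g \<zeta> * cnj (\<zeta> powi (n - 1))"
      using cnj_eq_inverse_circle[OF \<zeta>] by (simp add: power_int_diff power_int_inverse divide_inverse)
  qed
  also have "\<dots> = fourier_coeff f (n - 1)"
    using abs by (simp add: fourier_coeff_abs_L2)
  finally show ?thesis .
qed

lemma fourier_coeff_conj_L2: "fourier_coeff (conj_L2 f) n = cnj (fourier_coeff f (- n))"
proof (cases f)
  case (abs g)
  have "fourier_coeff (conj_L2 f) n = (LINT \<zeta>|circle. cnj (g \<zeta> * cnj (\<zeta> powi (- n))))"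
    unfolding abs(2) abs_L2_conj[OF abs(1)] fourier_coeff_abs_L2[OF L2_fun_cnj[OF abs(1)]]
  proof (intro Bochner_Integration.integral_cong refl)
    fix \<zeta> assume \<zeta>: "\<zeta> \<in> space circle"
    then show "cnj (g \<zeta>) * cnj (\<zeta> powi n) = cnj (g \<zeta> * cnj (\<zeta> powi (- n)))"
      using cnj_eq_inverse_circle[OF \<zeta>] by (simp add: power_int_minus power_int_inverse)
  qed
  also have "\<dots> = cnj (LINT \<zeta>|circle. g \<zeta> * cnj (\<zeta> powi (- n)))"
    by (rule Bochner_Integration.integral_cnj)
  also have "\<dots> = cnj (fourier_coeff f (- n))"
    using abs by (simp only: fourier_coeff_abs_L2)
  finally show ?thesis .
qed

text \<open>The map sending f to the conjugate of zf reflects frequency n to -n-1 and so exchanges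
  nonnegative and negative frequencies. As an involution it reaches every function with only
  negative frequencies, which yields the description of \<open>H2_0_conj\<close> by
  coefficients.\<close>

lemma conj_M_z_conj_M_z: "conj_L2 (M_z (conj_L2 (M_z f))) = f"
proof (cases f)
  case (abs g)
  have "AE \<zeta> in circle. cnj (\<zeta> * cnj (\<zeta> * g \<zeta>)) = g \<zeta>"
  proof (rule AE_I2)
    fix \<zeta> assume \<zeta>: "\<zeta> \<in> space circle"
    then have "\<zeta> \<noteq> 0" by (auto simp: space_circle)
    then show "cnj (\<zeta> * cnj (\<zeta> * g \<zeta>)) = g \<zeta>"
      using cnj_eq_inverse_circle[OF \<zeta>] by simp
  qed
  moreover have "conj_L2 (M_z (conj_L2 (M_z f))) = abs_L2 (\<lambda>\<zeta>. cnj (\<zeta> * cnj (\<zeta> * g \<zeta>)))"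
    unfolding abs(2) M_z_def
    by (simp only: mult_L2_abs_L2 abs_L2_conj L2_fun_mult L2_fun_cnj ess_bounded_id abs(1))
  moreover have "L2_fun (\<lambda>\<zeta>. cnj (\<zeta> * cnj (\<zeta> * g \<zeta>)))"
    by (intro L2_fun_cnj L2_fun_mult ess_bounded_id abs(1))
  ultimately show ?thesis
    using abs by (simp add: abs_L2_eq_iff)
qed

lemma H2_0_conj_eq: "H2_0_conj = {f. \<forall>n\<ge>0. fourier_coeff f n = 0}"
proof (intro equalityI subsetI)
  fix g assume "g \<in> {f. \<forall>n\<ge>0. fourier_coeff f n = 0}"
  then have "conj_L2 (M_z g) \<in> H2"
    by (auto simp: H2_def fourier_coeff_conj_L2 fourier_coeff_M_z)
  then show "g \<in> H2_0_conj"
    unfolding H2_0_conj_def by (metis conj_M_z_conj_M_z image_eqI)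
qed (auto simp: H2_0_conj_def H2_def fourier_coeff_conj_L2 fourier_coeff_M_z)

section \<open>Bessel's inequality and the sum over nonnegative frequencies\<close>

lemma bounded_linear_cinner_left: "bounded_linear (\<lambda>x. cinner x z)"
proof (rule bounded_linear_intro)
  show "cinner (x + y) z = cinner x z + cinner y z" for x y
    by (rule cinner_add_left)
  show "cinner (r *\<^sub>R x) z = r *\<^sub>R cinner x z" for r x
    by (simp add: scaleR_L2_def cinner_scaleC_left scaleR_conv_of_real)
  show "cmod (cinner x z) \<le> norm x * norm z" for x
    by (rule norm_cinner_le)
qed

lemma norm_sum_pow_L2_square:
  assumes "finite A"
  shows "(norm (\<Sum>n\<in>A. c n *\<^sub>C pow_L2 n))\<^sup>2 = (\<Sum>n\<in>A. (cmod (c n))\<^sup>2)"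
proof -
  let ?s = "\<Sum>n\<in>A. c n *\<^sub>C pow_L2 n"
  have s: "cinner ?s (pow_L2 n) = (if n \<in> A then c n else 0)" for n
    using assms by (simp add: cinner_sum_left cinner_scaleC_left cinner_pow_L2 if_distrib sum.delta cong: if_cong)
  have "complex_of_real ((norm ?s)\<^sup>2) = (\<Sum>n\<in>A. c n * cinner (pow_L2 n) ?s)"
    by (simp only: cinner_self[symmetric]) (simp add: cinner_sum_left[of _ _ ?s] cinner_scaleC_left)
  also have "\<dots> = (\<Sum>n\<in>A. c n * cnj (c n))"
    by (intro sum.cong refl) (simp add: cinner_commute[of "pow_L2 _" ?s] s)
  also have "\<dots> = complex_of_real (\<Sum>n\<in>A. (cmod (c n))\<^sup>2)"
    by (simp only: complex_norm_square of_real_sum)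
  finally show ?thesis
    by (simp only: of_real_eq_iff)
qed

text \<open>For the partial sum s over A, the inner product of s with f is the squared norm of s,
  and Cauchy-Schwarz then leaves \<open>norm s \<le> norm f\<close>.\<close>

lemma bessel_inequality:
  assumes "finite A"
  shows "(\<Sum>n\<in>A. (cmod (fourier_coeff f n))\<^sup>2) \<le> (norm f)\<^sup>2"
proof -
  let ?s = "\<Sum>n\<in>A. fourier_coeff f n *\<^sub>C pow_L2 n"
  have "cinner ?s f = (\<Sum>n\<in>A. fourier_coeff f n * cnj (fourier_coeff f n))"
    by (simp add: cinner_sum_left cinner_scaleC_left cinner_commute[of "pow_L2 _" f] fourier_coeff_eq_cinner)
  also have "\<dots> = complex_of_real ((norm ?s)\<^sup>2)"
    by (simp only: complex_norm_square[symmetric] norm_sum_pow_L2_square[OF assms] of_real_sum)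
  finally have "(norm ?s)\<^sup>2 = cmod (cinner ?s f)"
    by (simp only: norm_of_real) simp
  then have "norm ?s * norm ?s \<le> norm ?s * norm f"
    using norm_cinner_le[of ?s f] by (simp add: power2_eq_square)
  then have "norm ?s \<le> norm f"
    by (cases "norm ?s = 0") (auto simp: mult_le_cancel_left)
  then have "(norm ?s)\<^sup>2 \<le> (norm f)\<^sup>2"
    by (intro power_mono) auto
  then show ?thesis
    by (simp only: norm_sum_pow_L2_square[OF assms])
qed

text \<open>Orthonormality turns the squared norm of a block of the series into the same block of
  squared coefficients, whose series converges by Bessel. The completeness of \<open>L2\<close>
  enters here.\<close>

lemma summable_fourier_nonneg: "summable (\<lambda>n. fourier_coeff f (int n) *\<^sub>C pow_L2 (int n))"
proof -
  let ?c = "\<lambda>n. (cmod (fourier_coeff f (int n)))\<^sup>2"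
  have im: "(\<Sum>n\<in>A. g (int n)) = (\<Sum>n\<in>int ` A. g n)" for A and g :: "int \<Rightarrow> 'b::comm_monoid_add"
    by (simp add: sum.reindex)
  have "summable ?c"
  proof (rule summableI_nonneg_bounded)
    show "sum ?c {..<N} \<le> (norm f)\<^sup>2" for N
      unfolding im[of "\<lambda>n. (cmod (fourier_coeff f n))\<^sup>2"] by (rule bessel_inequality) simp
  qed simp
  show ?thesis
    unfolding summable_Cauchy
  proof (intro allI impI)
    fix e :: real assume "e > 0"
    then have "e\<^sup>2 > 0" by simp
    then obtain N where N: "\<And>m n. m \<ge> N \<Longrightarrow> norm (sum ?c {m..<n}) < e\<^sup>2"
      using \<open>summable ?c\<close> unfolding summable_Cauchy by meson
    have "norm (\<Sum>n\<in>{m..<n}. fourier_coeff f (int n) *\<^sub>C pow_L2 (int n)) < e" if "m \<ge> N" for m n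
    proof -
      have "(norm (\<Sum>n\<in>{m..<n}. fourier_coeff f (int n) *\<^sub>C pow_L2 (int n)))\<^sup>2 = sum ?c {m..<n}"
        unfolding im[of "\<lambda>n. fourier_coeff f n *\<^sub>C pow_L2 n"] im[of "\<lambda>n. (cmod (fourier_coeff f n))\<^sup>2"]
        by (rule norm_sum_pow_L2_square) simp
      also have "\<dots> < e\<^sup>2"
        using N[OF that, of n] by simp
      finally show ?thesis
        by (rule power_less_imp_less_base) (use \<open>e > 0\<close> in simp)
    qed
    then show "\<exists>N. \<forall>m\<ge>N. \<forall>n. norm (\<Sum>n\<in>{m..<n}. fourier_coeff f (int n) *\<^sub>C pow_L2 (int n)) < e"
      by blast
  qed
qed

text \<open>The explicit candidate for \<open>P_plus\<close>: since \<open>orth_proj\<close> is a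
  definite description, existence of the projection has to come from a construction.\<close>

definition riesz_proj :: "L2 \<Rightarrow> L2" where
  "riesz_proj f = (\<Sum>n. fourier_coeff f (int n) *\<^sub>C pow_L2 (int n))"

lemma cinner_riesz_proj_sums:
  "(\<lambda>n. fourier_coeff f (int n) * cinner (pow_L2 (int n)) h) sums cinner (riesz_proj f) h"
  using bounded_linear.sums[OF bounded_linear_cinner_left summable_sums[OF summable_fourier_nonneg, of f], of h]
  by (simp add: riesz_proj_def cinner_scaleC_left)

lemma fourier_coeff_riesz_proj:
  "fourier_coeff (riesz_proj f) m = (if m \<ge> 0 then fourier_coeff f m else 0)"
proof -
  have "(\<lambda>n. fourier_coeff f (int n) * cinner (pow_L2 (int n)) (pow_L2 m)) =
      (\<lambda>n. if m \<ge> 0 \<and> n = nat m then fourier_coeff f m else 0)"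
    by (auto simp: fun_eq_iff cinner_pow_L2)
  moreover have "\<dots> sums (if m \<ge> 0 then fourier_coeff f m else 0)"
    using sums_single[of "nat m" "\<lambda>_. fourier_coeff f m"] by auto
  ultimately show ?thesis
    using cinner_riesz_proj_sums[of f "pow_L2 m"] sums_unique2
    by (fastforce simp: fourier_coeff_eq_cinner)
qed

lemma riesz_proj_in_H2: "riesz_proj f \<in> H2"
  by (simp add: H2_def fourier_coeff_riesz_proj)

lemma diff_riesz_proj_in_H2_0_conj: "f - riesz_proj f \<in> H2_0_conj"
  by (simp add: H2_0_conj_eq fourier_coeff_diff fourier_coeff_riesz_proj)

lemma H2_eq_riesz_proj:
  assumes "f \<in> H2"
  shows "riesz_proj f = f"
proof -
  have "f - riesz_proj f = 0"
    using assms by (intro fourier_coeff_eq_0_imp)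
      (auto simp: fourier_coeff_diff fourier_coeff_riesz_proj H2_def)
  then show ?thesis by simp
qed

text \<open>Expand f into its own series of nonnegative powers; each power pairs with h to the
  conjugate of a vanishing coefficient of h.\<close>

lemma cinner_H2_H2_0_conj:
  assumes "f \<in> H2" "h \<in> H2_0_conj"
  shows "cinner f h = 0"
proof -
  have "cinner (pow_L2 (int n)) h = 0" for n
    using assms(2) cinner_commute[of "pow_L2 (int n)" h]
    by (simp add: H2_0_conj_eq fourier_coeff_eq_cinner)
  then have "(\<lambda>n. 0) sums cinner f h"
    using cinner_riesz_proj_sums[of f h] H2_eq_riesz_proj[OF assms(1)] by simp
  then show ?thesis
    using sums_unique2 sums_zero by blast
qed

lemma cinner_H2_0_conj_H2: "h \<in> H2_0_conj \<Longrightarrow> f \<in> H2 \<Longrightarrow> cinner h f = 0"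
  using cinner_commute[of h f] by (simp add: cinner_H2_H2_0_conj)

section \<open>Subspaces and orthogonal projections\<close>

definition csubspace_L2 :: "L2 set \<Rightarrow> bool" where
  "csubspace_L2 S \<longleftrightarrow> 0 \<in> S \<and> (\<forall>f\<in>S. \<forall>g\<in>S. f + g \<in> S) \<and> (\<forall>c. \<forall>f\<in>S. c *\<^sub>C f \<in> S)"

lemma uminus_eq_scaleC: "- f = (-1) *\<^sub>C f"
  using scaleR_minus1_left[of f] by (simp add: scaleR_L2_def)

lemma csubspace_L2_diff:
  assumes "csubspace_L2 S" "f \<in> S" "g \<in> S"
  shows "f - g \<in> S"
proof -
  have "f + (-1) *\<^sub>C g \<in> S"
    using assms by (auto simp: csubspace_L2_def)
  then show ?thesis
    by (simp add: uminus_eq_scaleC[symmetric])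
qed

lemma csubspace_H2: "csubspace_L2 H2"
  by (auto simp: csubspace_L2_def H2_def fourier_coeff_add fourier_coeff_scaleC fourier_coeff_eq_cinner[of 0])

lemma csubspace_H2_0_conj: "csubspace_L2 H2_0_conj"
  by (auto simp: csubspace_L2_def H2_0_conj_eq fourier_coeff_add fourier_coeff_scaleC fourier_coeff_eq_cinner[of 0])

lemma csubspace_orth_compl: "csubspace_L2 (orth_compl S)"
  by (auto simp: csubspace_L2_def orth_compl_def cinner_add_left cinner_scaleC_left)

lemma csubspace_Int: "csubspace_L2 S \<Longrightarrow> csubspace_L2 T \<Longrightarrow> csubspace_L2 (S \<inter> T)"
  by (auto simp: csubspace_L2_def)

text \<open>Two candidates differ by an element of both S and its orthogonal complement, which is
  orthogonal to itself. All projections are evaluated through this rule, by displaying a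
  decomposition.\<close>

lemma orth_proj_eqI:
  assumes S: "csubspace_L2 S" and g: "g \<in> S" "f - g \<in> orth_compl S"
  shows "orth_proj S f = g"
  unfolding orth_proj_def
proof (rule the_equality)
  fix g' assume g': "g' \<in> S \<and> f - g' \<in> orth_compl S"
  have "(f - g) - (f - g') \<in> orth_compl S"
    by (rule csubspace_L2_diff[OF csubspace_orth_compl]) (use g g' in auto)
  moreover have "g' - g \<in> S"
    by (rule csubspace_L2_diff[OF S]) (use g g' in auto)
  ultimately have "cinner (g' - g) (g' - g) = 0"
    by (auto simp: orth_compl_def)
  then show "g' = g" by simp
qed (use g in simp)

lemma P_plus_eqI:
  assumes "g \<in> H2" "f - g \<in> H2_0_conj"
  shows "P_plus f = g"
  unfolding P_plus_def using assms
  by (intro orth_proj_eqI csubspace_H2) (auto simp: orth_compl_def cinner_H2_0_conj_H2)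

lemma P_minus_eqI:
  assumes "g \<in> H2_0_conj" "f - g \<in> H2"
  shows "P_minus f = g"
  unfolding P_minus_def using assms
  by (intro orth_proj_eqI csubspace_H2_0_conj) (auto simp: orth_compl_def cinner_H2_H2_0_conj)

lemma P_plus_eq_riesz_proj: "P_plus f = riesz_proj f"
  by (rule P_plus_eqI[OF riesz_proj_in_H2 diff_riesz_proj_in_H2_0_conj])

lemma P_plus_in_H2 [simp, intro]: "P_plus f \<in> H2"
  by (simp add: P_plus_eq_riesz_proj riesz_proj_in_H2)

lemma P_minus_eq: "P_minus f = f - P_plus f"
  by (rule P_minus_eqI) (auto simp: P_plus_eq_riesz_proj diff_riesz_proj_in_H2_0_conj riesz_proj_in_H2)

lemma P_minus_in_H2_0_conj [simp, intro]: "P_minus f \<in> H2_0_conj"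
  by (simp add: P_minus_eq P_plus_eq_riesz_proj diff_riesz_proj_in_H2_0_conj)

lemma P_plus_sum: "g \<in> H2_0_conj \<Longrightarrow> h \<in> H2 \<Longrightarrow> P_plus (g + h) = h"
  by (rule P_plus_eqI) auto

lemma P_minus_sum: "g \<in> H2_0_conj \<Longrightarrow> h \<in> H2 \<Longrightarrow> P_minus (g + h) = g"
  by (rule P_minus_eqI) auto

lemma P_plus_add: "P_plus (f + g) = P_plus f + P_plus g"
proof (rule P_plus_eqI)
  have "(f - P_plus f) + (g - P_plus g) \<in> H2_0_conj"
    using csubspace_H2_0_conj P_minus_in_H2_0_conj[of f] P_minus_in_H2_0_conj[of g]
    unfolding P_minus_eq csubspace_L2_def by blast
  then show "f + g - (P_plus f + P_plus g) \<in> H2_0_conj"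
    by (simp add: algebra_simps)
qed (use csubspace_H2 in \<open>auto simp: csubspace_L2_def\<close>)

lemma P_plus_scaleC: "P_plus (c *\<^sub>C f) = c *\<^sub>C P_plus f"
proof (rule P_plus_eqI)
  have "c *\<^sub>C (f - P_plus f) \<in> H2_0_conj"
    using csubspace_H2_0_conj P_minus_in_H2_0_conj[of f]
    unfolding P_minus_eq csubspace_L2_def by blast
  then show "c *\<^sub>C f - c *\<^sub>C P_plus f \<in> H2_0_conj"
    by (simp add: scaleC_diff_right)
qed (use csubspace_H2 in \<open>auto simp: csubspace_L2_def\<close>)

lemma norm_P_plus_le: "norm (P_plus f) \<le> norm f"
proof -
  have "cinner (f - P_plus f) (P_plus f) = 0"
    using cinner_H2_0_conj_H2[OF P_minus_in_H2_0_conj P_plus_in_H2] by (simp add: P_minus_eq)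
  then have "cinner f (P_plus f) = complex_of_real ((norm (P_plus f))\<^sup>2)"
    by (simp only: cinner_diff_left cinner_self) simp
  then have "(norm (P_plus f))\<^sup>2 = cmod (cinner f (P_plus f))"
    by (simp only: norm_of_real) simp
  then have "norm (P_plus f) * norm (P_plus f) \<le> norm f * norm (P_plus f)"
    using norm_cinner_le[of f "P_plus f"] by (simp add: power2_eq_square)
  then show ?thesis
    by (cases "norm (P_plus f) = 0") (auto simp: mult_le_cancel_right)
qed

section \<open>Boundary values of inner functions\<close>

text \<open>Only countably many radii enter the criterion, which makes the set of points with a
  radial limit measurable.\<close>

lemma at_left_limit_iff_rational_Cauchy:
  fixes g :: "real \<Rightarrow> 'a::complete_space"
  assumes cont: "continuous_on {0..<1} g"
  shows "(\<exists>l. (g \<longlongrightarrow> l) (at_left 1)) \<longleftrightarrow>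
    (\<forall>k::nat. \<exists>N::nat. \<forall>p q::rat. 1 - 1 / real (Suc N) < of_rat p \<and> p < 1 \<and>
        1 - 1 / real (Suc N) < of_rat q \<and> q < 1 \<longrightarrow>
        dist (g (of_rat p)) (g (of_rat q)) \<le> 1 / real (Suc k))"
    (is "?L \<longleftrightarrow> ?R")
proof
  assume ?L
  then obtain l where l: "(g \<longlongrightarrow> l) (at_left 1)" by blast
  show ?R
  proof
    fix k :: nat
    have "eventually (\<lambda>r. dist (g r) l < 1 / real (Suc k) / 2) (at_left 1)"
      using l by (rule tendstoD) simp
    then obtain b where b: "b < 1" "\<And>r. b < r \<Longrightarrow> r < 1 \<Longrightarrow> dist (g r) l < 1 / real (Suc k) / 2"
      unfolding eventually_at_left_field by blast
    obtain N where N: "1 / real (Suc N) < 1 - b"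
      using nat_approx_posE[of "1 - b"] b(1) by auto
    have "dist (g (of_rat p)) (g (of_rat q)) \<le> 1 / real (Suc k)"
      if "1 - 1 / real (Suc N) < of_rat p" "p < 1" "1 - 1 / real (Suc N) < of_rat q" "q < 1" for p q
    proof -
      have "dist (g (of_rat p)) (g (of_rat q)) \<le> dist (g (of_rat p)) l + dist (g (of_rat q)) l"
        by (rule dist_triangle2)
      also have "\<dots> \<le> 1 / real (Suc k)"
      proof -
        have "real_of_rat p < 1" "real_of_rat q < 1"
          using that by simp_all
        then have "dist (g (of_rat p)) l < 1 / real (Suc k) / 2" "dist (g (of_rat q)) l < 1 / real (Suc k) / 2"
          using that N by (intro b(2); linarith)+
        then show ?thesis by linarith
      qed
      finally show ?thesis .
    qed
    then show "\<exists>N::nat. \<forall>p q::rat. 1 - 1 / real (Suc N) < of_rat p \<and> p < 1 \<and>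
        1 - 1 / real (Suc N) < of_rat q \<and> q < 1 \<longrightarrow>
        dist (g (of_rat p)) (g (of_rat q)) \<le> 1 / real (Suc k)"
      by blast
  qed
next
  assume R: ?R
  \<comment> \<open>A rational sequence increasing to 1. The double \<open>Suc\<close> puts
    \<open>s n\<close> strictly beyond the threshold \<open>1 - 1 / real (Suc N)\<close> already at
    \<open>n = N\<close>.\<close>
  define s :: "nat \<Rightarrow> rat" where "s n = 1 - 1 / of_nat (Suc (Suc n))" for n
  have s: "real_of_rat (s n) = 1 - 1 / real (Suc (Suc n))" "s n < 1" for n
    by (simp_all add: s_def of_rat_diff of_rat_divide of_rat_add)
  have s_gt: "1 - 1 / real (Suc N) < of_rat (s n)" if "n \<ge> N" for n N
    unfolding s using that by (simp add: frac_less2)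
  have "Cauchy (\<lambda>n. g (of_rat (s n)))"
  proof (rule metric_CauchyI)
    fix e :: real assume "e > 0"
    then obtain k where k: "1 / real (Suc k) < e"
      using nat_approx_posE by blast
    from R obtain N where N: "\<And>p q::rat. 1 - 1 / real (Suc N) < of_rat p \<Longrightarrow> p < 1 \<Longrightarrow>
        1 - 1 / real (Suc N) < of_rat q \<Longrightarrow> q < 1 \<Longrightarrow>
        dist (g (of_rat p)) (g (of_rat q)) \<le> 1 / real (Suc k)"
      by meson
    have "dist (g (of_rat (s m))) (g (of_rat (s n))) < e" if "m \<ge> N" "n \<ge> N" for m n
      using N[of "s m" "s n"] s_gt[OF that(1)] s_gt[OF that(2)] s(2) k by force
    then show "\<exists>M. \<forall>m\<ge>M. \<forall>n\<ge>M. dist (g (of_rat (s m))) (g (of_rat (s n))) < e"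
      by blast
  qed
  then obtain l where l: "(\<lambda>n. g (of_rat (s n))) \<longlonglongrightarrow> l"
    using Cauchy_convergent convergent_def by blast
  have "(g \<longlongrightarrow> l) (at_left 1)"
  proof (rule tendstoI)
    fix e :: real assume "e > 0"
    then obtain k where k: "1 / real (Suc k) < e"
      using nat_approx_posE by blast
    from R obtain N where N: "\<And>p q::rat. 1 - 1 / real (Suc N) < of_rat p \<Longrightarrow> p < 1 \<Longrightarrow>
        1 - 1 / real (Suc N) < of_rat q \<Longrightarrow> q < 1 \<Longrightarrow>
        dist (g (of_rat p)) (g (of_rat q)) \<le> 1 / real (Suc k)"
      by meson
    have rat: "dist (g (of_rat p)) l \<le> 1 / real (Suc k)"
      if "1 - 1 / real (Suc N) < of_rat p" "p < 1" for p
    proof (rule LIMSEQ_le_const2)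
      show "(\<lambda>n. dist (g (of_rat p)) (g (of_rat (s n)))) \<longlonglongrightarrow> dist (g (of_rat p)) l"
        by (intro tendsto_intros l)
      show "\<exists>M. \<forall>n\<ge>M. dist (g (of_rat p)) (g (of_rat (s n))) \<le> 1 / real (Suc k)"
        using N[OF that] s_gt s(2) by blast
    qed
    have "dist (g r) l \<le> 1 / real (Suc k)" if r: "1 - 1 / real (Suc N) < r" "r < 1" for r
    \<comment> \<open>If the bound failed at a real r, continuity would make it fail just to the
      right of r, hence at a rational point that is still above the threshold and below 1.\<close>
    proof (rule ccontr)
      assume neg: "\<not> dist (g r) l \<le> 1 / real (Suc k)"
      have "1 / real (Suc N) \<le> 1"
        by simp
      then have r0: "0 < r" using r by linarith
      have "continuous_on {0<..<1} g"
        using cont by (rule continuous_on_subset) auto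
      then have "isCont g r"
        using r0 r by (simp add: continuous_on_eq_continuous_at)
      then have "((\<lambda>x. dist (g x) l) \<longlongrightarrow> dist (g r) l) (at r)"
        unfolding isCont_def by (intro tendsto_intros)
      then have "eventually (\<lambda>x. 1 / real (Suc k) < dist (g x) l) (at r)"
        using neg by (intro order_tendstoD) auto
      then have "eventually (\<lambda>x. 1 / real (Suc k) < dist (g x) l) (at_right r)"
        by (rule filter_leD[OF at_le, rotated]) simp
      then obtain b where b: "r < b" "\<And>x. r < x \<Longrightarrow> x < b \<Longrightarrow> 1 / real (Suc k) < dist (g x) l"
        unfolding eventually_at_right_field by blast
      obtain p :: rat where p: "r < of_rat p" "of_rat p < min b 1"
        using of_rat_dense[of r "min b 1"] b(1) r by auto
      then have "dist (g (of_rat p)) l \<le> 1 / real (Suc k)"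
        using r by (intro rat) auto
      then show False
        using b(2)[of "of_rat p"] p by simp
    qed
    then have "dist (g r) l < e" if "1 - 1 / real (Suc N) < r" "r < 1" for r
      using that k by force
    then show "eventually (\<lambda>r. dist (g r) l < e) (at_left 1)"
      unfolding eventually_at_left_field
      by (intro exI[of _ "1 - 1 / real (Suc N)"]) auto
  qed
  then show ?L by blast
qed

lemma radial_measurable:
  assumes "u holomorphic_on ball 0 1" "0 \<le> r" "r < 1"
  shows "(\<lambda>\<zeta>. u (complex_of_real r * \<zeta>)) \<in> borel_measurable circle"
proof (rule circle_measurableI)
  have "continuous_on (ball 0 1) u"
    using assms by (intro holomorphic_on_imp_continuous_on)
  then show "continuous_on (sphere 0 1) (\<lambda>\<zeta>. u (complex_of_real r * \<zeta>))"
    by (rule continuous_on_compose2) (use assms in \<open>auto simp: norm_mult intro!: continuous_intros\<close>)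
qed

lemma filterlim_at_left_1: "filterlim (\<lambda>n. 1 - 1 / real (Suc n)) (at_left 1) sequentially"
  by real_asymp

text \<open>On the set G of points with a radial limit, \<open>boundary u\<close> is the limit along
  a fixed sequence of radii; off G it is a constant. G is measurable because the criterion by
  rational radii uses only countable quantifiers.\<close>

lemma boundary_measurable:
  assumes u: "u holomorphic_on ball 0 1"
  shows "boundary u \<in> borel_measurable circle"
proof -
  \<comment> \<open>Extending by 0 makes the slice measurable for every radius, as the quantifiers
    in G range over all rationals.\<close>
  define f where "f r \<zeta> = (if 0 \<le> r \<and> r < 1 then u (complex_of_real r * \<zeta>) else 0)" for r \<zeta>
  have [measurable]: "f r \<in> borel_measurable circle" for r
    using radial_measurable[OF u, of r] unfolding f_def[abs_def]
    by (cases "0 \<le> r \<and> r < 1") auto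
  have "1 - 1 / real (Suc N) \<ge> 0" for N
    by simp
  then have nonneg: "0 \<le> x" if "1 - 1 / real (Suc N) < x" for x N
    using that by (meson less_imp_le order_trans)
  define G where "G = {\<zeta> \<in> space circle. \<forall>k::nat. \<exists>N::nat. \<forall>p q::rat.
        1 - 1 / real (Suc N) < of_rat p \<and> p < 1 \<and> 1 - 1 / real (Suc N) < of_rat q \<and> q < 1 \<longrightarrow>
        dist (f (of_rat p) \<zeta>) (f (of_rat q) \<zeta>) \<le> 1 / real (Suc k)}"
  have [measurable]: "G \<in> sets circle"
    unfolding G_def by measurable
  have G: "\<zeta> \<in> G \<longleftrightarrow> (\<exists>l. ((\<lambda>r. u (complex_of_real r * \<zeta>)) \<longlongrightarrow> l) (at_left 1))"
    if \<zeta>: "\<zeta> \<in> space circle" for \<zeta>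
  proof -
    have "continuous_on (ball 0 1) u"
      using u by (intro holomorphic_on_imp_continuous_on)
    then have "continuous_on {0..<1} (\<lambda>r. u (complex_of_real r * \<zeta>))"
      by (rule continuous_on_compose2)
        (use \<zeta> in \<open>auto simp: norm_mult space_circle intro!: continuous_intros\<close>)
    then have c: "continuous_on {0..<1} (\<lambda>r. f r \<zeta>)"
      by (subst continuous_on_cong[OF refl, of _ _ "\<lambda>r. u (complex_of_real r * \<zeta>)"]) (auto simp: f_def)
    have "eventually (\<lambda>r. f r \<zeta> = u (complex_of_real r * \<zeta>)) (at_left 1)"
      unfolding eventually_at_left_field by (intro exI[of _ 0]) (auto simp: f_def)
    then have "((\<lambda>r. u (complex_of_real r * \<zeta>)) \<longlongrightarrow> l) (at_left 1) \<longleftrightarrow>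
        ((\<lambda>r. f r \<zeta>) \<longlongrightarrow> l) (at_left 1)" for l
      by (intro tendsto_cong) (auto elim: eventually_mono)
    then show ?thesis
      using at_left_limit_iff_rational_Cauchy[OF c] \<zeta> by (simp add: G_def)
  qed
  define r where "r n = 1 - 1 / real (Suc n)" for n
  \<comment> \<open>The value that \<open>Lim\<close> takes where no limit exists: the description
    of an unsatisfiable predicate, hence the same at every such point.\<close>
  define c :: complex where "c = (THE l. False)"
  have r: "0 \<le> r n" "r n < 1" for n
    by (auto simp: r_def)
  have rl: "filterlim r (at_left 1) sequentially"
    unfolding r_def[abs_def] by (rule filterlim_at_left_1)
  have "boundary u \<zeta> = (if \<zeta> \<in> G then lim (\<lambda>n. f (r n) \<zeta>) else c)" if \<zeta>: "\<zeta> \<in> space circle" for \<zeta>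
  proof (cases "\<zeta> \<in> G")
    case True
    then obtain l where l: "((\<lambda>r. u (complex_of_real r * \<zeta>)) \<longlongrightarrow> l) (at_left 1)"
      using G[OF \<zeta>] by blast
    then have "boundary u \<zeta> = l"
      unfolding boundary_def by (intro tendsto_Lim) auto
    moreover have "(\<lambda>n. f (r n) \<zeta>) \<longlonglongrightarrow> l"
      using filterlim_compose[OF l rl] r by (simp add: f_def)
    ultimately show ?thesis
      using True by (simp add: limI)
  next
    case False
    then show ?thesis
      using G[OF \<zeta>] by (simp add: boundary_def Topological_Spaces.Lim_def c_def)
  qed
  moreover have "(\<lambda>\<zeta>. if \<zeta> \<in> G then lim (\<lambda>n. f (r n) \<zeta>) else c) \<in> borel_measurable circle"
    by measurable
  ultimately show ?thesis
    by (subst measurable_cong) auto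
qed

section \<open>Fourier coefficients of boundary functions\<close>

lemma inner_function_boundary_AE:
  assumes "inner_function u"
  shows "AE \<zeta> in circle. cmod (boundary u \<zeta>) = 1 \<and>
    ((\<lambda>r. u (complex_of_real r * \<zeta>)) \<longlongrightarrow> boundary u \<zeta>) (at_left 1)"
proof -
  have "AE \<zeta> in circle. \<exists>l. cmod l = 1 \<and> ((\<lambda>r. u (complex_of_real r * \<zeta>)) \<longlongrightarrow> l) (at_left 1)"
    using assms by (simp add: inner_function_def)
  then show ?thesis
  proof eventually_elim
    case (elim \<zeta>)
    then obtain l where l: "cmod l = 1" "((\<lambda>r. u (complex_of_real r * \<zeta>)) \<longlongrightarrow> l) (at_left 1)"
      by blast
    have "boundary u \<zeta> = l"
      unfolding boundary_def by (rule tendsto_Lim) (use l in auto)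
    with l show ?case by simp
  qed
qed

text \<open>Expand u into its Taylor series on the circle of radius r. After multiplication by
  \<open>\<zeta> powi m\<close> with m nonnegative, the only term that can have nonzero mean is the
  constant one, and absolute convergence permits termwise integration.\<close>

lemma integral_radial_powi:
  assumes u: "u holomorphic_on ball 0 1" and r: "0 \<le> r" "r < 1" and m: "m \<ge> 0"
  shows "(LINT \<zeta>|circle. u (complex_of_real r * \<zeta>) * \<zeta> powi m) = (if m = 0 then u 0 else 0)"
proof -
  define a where "a j = (deriv ^^ j) u 0 / fact j" for j
  have ps: "(\<lambda>j. a j * w ^ j) sums u w" if "cmod w < 1" for w
    using holomorphic_power_series[OF u, of w] that by (simp add: a_def)
  define f where "f j \<zeta> = a j * complex_of_real r ^ j * \<zeta> powi (int j + m)" for j \<zeta>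
  have sums: "(\<lambda>j. f j \<zeta>) sums (u (complex_of_real r * \<zeta>) * \<zeta> powi m)" if "\<zeta> \<in> space circle" for \<zeta>
  proof -
    have "\<zeta> \<noteq> 0" "cmod \<zeta> = 1"
      using that by (auto simp: space_circle)
    then have "(\<lambda>j. a j * (complex_of_real r * \<zeta>) ^ j * \<zeta> powi m) sums (u (complex_of_real r * \<zeta>) * \<zeta> powi m)"
      using r by (intro sums_mult2 ps) (simp add: norm_mult)
    moreover have "a j * (complex_of_real r * \<zeta>) ^ j * \<zeta> powi m = f j \<zeta>" for j
      using \<open>\<zeta> \<noteq> 0\<close> by (simp add: f_def power_int_add power_mult_distrib)
    ultimately show ?thesis by simp
  qed
  have "summable (\<lambda>j. norm (a j * complex_of_real r ^ j))"
  proof (rule powser_insidea)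
    \<comment> \<open>The radius \<open>(1 + r) / 2\<close> lies strictly between r and 1:
      convergence there gives absolute convergence at r.\<close>
    show "summable (\<lambda>j. a j * complex_of_real ((1 + r) / 2) ^ j)"
      by (rule sums_summable[OF ps]) (use r in \<open>simp only: norm_of_real\<close>, simp)
    show "norm (complex_of_real r) < norm (complex_of_real ((1 + r) / 2))"
      using r by (simp only: norm_of_real) simp
  qed
  then have summ: "summable (\<lambda>j. norm (f j \<zeta>))" if "\<zeta> \<in> space circle" for \<zeta>
    using that by (simp add: f_def norm_mult norm_power_int space_circle)
  have int: "integrable circle (f j)" for j
    unfolding f_def by (intro integrable_mult_right L2_fun_integrable L2_fun_powi)
  have norm_int: "(LINT \<zeta>|circle. norm (f j \<zeta>)) = norm (a j * complex_of_real r ^ j)" for j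
  proof -
    have "(LINT \<zeta>|circle. norm (f j \<zeta>)) = (LINT \<zeta>|circle. norm (a j * complex_of_real r ^ j))"
      by (intro Bochner_Integration.integral_cong)
        (auto simp: f_def norm_mult norm_power_int space_circle)
    then show ?thesis by simp
  qed
  have "(\<lambda>j. LINT \<zeta>|circle. f j \<zeta>) sums (LINT \<zeta>|circle. (\<Sum>j. f j \<zeta>))"
  proof (rule sums_integral[OF int])
    show "AE \<zeta> in circle. summable (\<lambda>j. norm (f j \<zeta>))"
      using summ by (intro AE_I2)
    show "summable (\<lambda>j. LINT \<zeta>|circle. norm (f j \<zeta>))"
      unfolding norm_int by fact
  qed
  moreover have "(LINT \<zeta>|circle. (\<Sum>j. f j \<zeta>)) = (LINT \<zeta>|circle. u (complex_of_real r * \<zeta>) * \<zeta> powi m)"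
    by (intro Bochner_Integration.integral_cong refl sums_unique[symmetric] sums)
  moreover have "(\<lambda>j. LINT \<zeta>|circle. f j \<zeta>) = (\<lambda>j. if j = 0 then (if m = 0 then u 0 else 0) else 0)"
    using m by (auto simp: fun_eq_iff f_def integral_circle_powi a_def)
  moreover have "\<dots> sums (if m = 0 then u 0 else 0)"
    using sums_single[of 0 "\<lambda>_. if m = 0 then u 0 else 0"] by simp
  ultimately show ?thesis
    using sums_unique2 by force
qed

text \<open>Let the radius tend to 1 under the uniform bound on u. This links the holomorphic
  definition to Fourier coefficients: positive m rules out negative frequencies, and m = 0
  identifies the mean.\<close>

lemma integral_boundary_powi:
  assumes u: "inner_function u" and m: "m \<ge> 0"
  shows "(LINT \<zeta>|circle. boundary u \<zeta> * \<zeta> powi m) = (if m = 0 then u 0 else 0)"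
proof -
  have hol: "u holomorphic_on ball 0 1"
    using u by (simp add: inner_function_def)
  obtain B where "\<forall>w\<in>ball 0 1. cmod (u w) \<le> B"
    using u by (auto simp: inner_function_def bounded_iff)
  then have B: "\<And>w. cmod w < 1 \<Longrightarrow> cmod (u w) \<le> B"
    by simp
  define r where "r n = 1 - 1 / real (Suc n)" for n
  have r: "0 \<le> r n" "r n < 1" for n
    by (auto simp: r_def)
  have rl: "filterlim r (at_left 1) sequentially"
    unfolding r_def[abs_def] by (rule filterlim_at_left_1)
  have "(\<lambda>n. LINT \<zeta>|circle. u (complex_of_real (r n) * \<zeta>) * \<zeta> powi m) \<longlonglongrightarrow>
      (LINT \<zeta>|circle. boundary u \<zeta> * \<zeta> powi m)"
  proof (rule integral_dominated_convergence[where w = "\<lambda>_. B"])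
    show "AE \<zeta> in circle. (\<lambda>n. u (complex_of_real (r n) * \<zeta>) * \<zeta> powi m) \<longlonglongrightarrow> boundary u \<zeta> * \<zeta> powi m"
      using inner_function_boundary_AE[OF u]
    proof eventually_elim
      case (elim \<zeta>)
      then have "((\<lambda>r. u (complex_of_real r * \<zeta>)) \<longlongrightarrow> boundary u \<zeta>) (at_left 1)"
        by simp
      from filterlim_compose[OF this rl] show ?case
        by (intro tendsto_intros) auto
    qed
    show "AE \<zeta> in circle. norm (u (complex_of_real (r n) * \<zeta>) * \<zeta> powi m) \<le> B" for n
      using r[of n] by (intro AE_I2)
        (auto simp: norm_mult norm_power_int space_circle intro!: B)
    have [measurable]: "boundary u \<in> borel_measurable circle"
      by (rule boundary_measurable[OF hol])
    show "(\<lambda>\<zeta>. boundary u \<zeta> * \<zeta> powi m) \<in> borel_measurable circle"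
      by measurable
    have [measurable]: "(\<lambda>\<zeta>. u (complex_of_real (r n) * \<zeta>)) \<in> borel_measurable circle" for n
      by (rule radial_measurable[OF hol r])
    show "(\<lambda>\<zeta>. u (complex_of_real (r n) * \<zeta>) * \<zeta> powi m) \<in> borel_measurable circle" for n
      by measurable
  qed simp
  then show ?thesis
    by (simp add: integral_radial_powi[OF hol r m] LIMSEQ_const_iff)
qed

lemma ess_bounded_boundary:
  assumes "inner_function u"
  shows "ess_bounded (boundary u)"
  unfolding ess_bounded_def
proof
  show "boundary u \<in> borel_measurable circle"
    using assms by (intro boundary_measurable) (simp add: inner_function_def)
  show "\<exists>C. AE \<zeta> in circle. cmod (boundary u \<zeta>) \<le> C"
    using inner_function_boundary_AE[OF assms] by (intro exI[of _ 1]) (auto elim: eventually_mono)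
qed

text \<open>The hypothesis \<open>n \<le> m\<close> keeps the exponent \<open>m - n\<close>
  nonnegative, the range in which the moments of \<open>boundary u\<close> are known.\<close>

lemma fourier_coeff_mult_boundary_pow_L2:
  assumes u: "inner_function u" and "n \<le> m"
  shows "fourier_coeff (mult_L2 (boundary u) (pow_L2 m)) n = (if n = m then u 0 else 0)"
proof -
  have "fourier_coeff (mult_L2 (boundary u) (pow_L2 m)) n =
      (LINT \<zeta>|circle. boundary u \<zeta> * \<zeta> powi m * cnj (\<zeta> powi n))"
    using ess_bounded_boundary[OF u]
    by (simp add: pow_L2_def mult_L2_abs_L2 fourier_coeff_abs_L2 L2_fun_mult L2_fun_powi)
  also have "\<dots> = (LINT \<zeta>|circle. boundary u \<zeta> * \<zeta> powi (m - n))"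
  proof (intro Bochner_Integration.integral_cong refl)
    fix \<zeta> assume \<zeta>: "\<zeta> \<in> space circle"
    then have "\<zeta> \<noteq> 0" by (auto simp: space_circle)
    then show "boundary u \<zeta> * \<zeta> powi m * cnj (\<zeta> powi n) = boundary u \<zeta> * \<zeta> powi (m - n)"
      using cnj_eq_inverse_circle[OF \<zeta>] by (simp add: power_int_diff power_int_inverse divide_inverse)
  qed
  also have "\<dots> = (if n = m then u 0 else 0)"
    using integral_boundary_powi[OF u, of "m - n"] assms(2) by simp
  finally show ?thesis .
qed

section \<open>The dual of the compressed shift\<close>

lemma pow_L2_in_H2: "n \<ge> 0 \<Longrightarrow> pow_L2 n \<in> H2"
  by (auto simp: H2_def fourier_coeff_pow_L2)

lemma pow_L2_in_H2_0_conj: "n < 0 \<Longrightarrow> pow_L2 n \<in> H2_0_conj"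
  by (auto simp: H2_0_conj_eq fourier_coeff_pow_L2)

lemma M_z_in_H2: "f \<in> H2 \<Longrightarrow> M_z f \<in> H2"
  by (auto simp: H2_def fourier_coeff_M_z)

lemma M_z_diff_in_H2_0_conj:
  "g \<in> H2_0_conj \<Longrightarrow> M_z g - fourier_coeff g (-1) *\<^sub>C pow_L2 0 \<in> H2_0_conj"
  by (auto simp: H2_0_conj_eq fourier_coeff_diff fourier_coeff_scaleC fourier_coeff_M_z
      fourier_coeff_pow_L2)

lemma M_z_add: "M_z (f + g) = M_z f + M_z g"
  and M_z_scaleC: "M_z (c *\<^sub>C f) = c *\<^sub>C M_z f"
  by (simp_all add: M_z_def mult_L2_add mult_L2_scaleC)

lemma H2_add: "f \<in> H2 \<Longrightarrow> g \<in> H2 \<Longrightarrow> f + g \<in> H2"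
  and H2_scaleC: "f \<in> H2 \<Longrightarrow> c *\<^sub>C f \<in> H2"
  using csubspace_H2 by (auto simp: csubspace_L2_def)

lemma mult_L2_scaled_left:
  "ess_bounded \<phi> \<Longrightarrow> mult_L2 (\<lambda>\<zeta>. c * \<phi> \<zeta>) f = c *\<^sub>C mult_L2 \<phi> f"
  using mult_L2_mult_L2[of "\<lambda>_. c" \<phi> f] by (simp add: mult_L2_const)

section \<open>Bounded operators on the whole space\<close>

lemma bounded_op_UNIV_iff:
  "bounded_op UNIV UNIV A \<longleftrightarrow> (\<forall>f g. A (f + g) = A f + A g) \<and>
     (\<forall>c f. A (c *\<^sub>C f) = c *\<^sub>C A f) \<and> (\<exists>C. \<forall>f. norm (A f) \<le> C * norm f)"
  by (simp add: bounded_op_def)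

text \<open>The operators are total functions given by formulas that are bounded on all of
  \<open>L2\<close>, so boundedness is proved there and only the mapping between subspaces is
  checked separately.\<close>

lemma bounded_op_restrict:
  "bounded_op UNIV UNIV A \<Longrightarrow> (\<And>f. f \<in> S \<Longrightarrow> A f \<in> T) \<Longrightarrow> bounded_op S T A"
  by (auto simp: bounded_op_def)

lemma bounded_op_add:
  assumes "bounded_op UNIV UNIV A" "bounded_op UNIV UNIV B"
  shows "bounded_op UNIV UNIV (\<lambda>f. A f + B f)"
proof -
  obtain C D where "\<And>f. norm (A f) \<le> C * norm f" "\<And>f. norm (B f) \<le> D * norm f"
    using assms by (auto simp: bounded_op_UNIV_iff)
  then have "norm (A f + B f) \<le> (C + D) * norm f" for f
    by (smt (verit) distrib_right norm_triangle_ineq)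
  then show ?thesis
    using assms by (auto simp: bounded_op_UNIV_iff scaleC_add_right)
qed

lemma bounded_op_scaleC:
  assumes "bounded_op UNIV UNIV A"
  shows "bounded_op UNIV UNIV (\<lambda>f. c *\<^sub>C A f)"
proof -
  obtain C where "\<And>f. norm (A f) \<le> C * norm f"
    using assms by (auto simp: bounded_op_UNIV_iff)
  then have "norm (c *\<^sub>C A f) \<le> (cmod c * C) * norm f" for f
    by (simp add: norm_scaleC mult.assoc mult_left_mono)
  then have "\<exists>D. \<forall>f. norm (c *\<^sub>C A f) \<le> D * norm f"
    by blast
  then show ?thesis
    using assms by (simp add: bounded_op_UNIV_iff scaleC_add_right scaleC_scaleC mult.commute[of c])
qed

lemma bounded_op_diff:
  assumes "bounded_op UNIV UNIV A" "bounded_op UNIV UNIV B"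
  shows "bounded_op UNIV UNIV (\<lambda>f. A f - B f)"
  using bounded_op_add[OF assms(1) bounded_op_scaleC[OF assms(2), of "-1"]]
  by (simp add: uminus_eq_scaleC[symmetric])

lemma bounded_op_compose:
  assumes "bounded_op UNIV UNIV A" "bounded_op UNIV UNIV B"
  shows "bounded_op UNIV UNIV (\<lambda>f. A (B f))"
proof -
  obtain C D where C: "\<And>f. norm (A f) \<le> C * norm f" and D: "\<And>f. norm (B f) \<le> D * norm f"
    using assms by (auto simp: bounded_op_UNIV_iff)
  have "norm (A (B f)) \<le> (\<bar>C\<bar> * D) * norm f" for f
  proof -
    have "norm (A (B f)) \<le> C * norm (B f)"
      by (rule C)
    also have "\<dots> \<le> \<bar>C\<bar> * norm (B f)"
      by (intro mult_right_mono) auto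
    also have "\<dots> \<le> \<bar>C\<bar> * (D * norm f)"
      by (intro mult_left_mono D) auto
    finally show ?thesis by (simp add: mult.assoc)
  qed
  then show ?thesis
    using assms by (auto simp: bounded_op_UNIV_iff)
qed

lemma bounded_op_mult_L2:
  assumes "ess_bounded \<phi>"
  shows "bounded_op UNIV UNIV (mult_L2 \<phi>)"
  using norm_mult_L2_bounded[OF assms] assms
  by (metis bounded_op_UNIV_iff mult_L2_add mult_L2_scaleC)

lemma bounded_op_ident: "bounded_op UNIV UNIV (\<lambda>f. f)"
  by (auto simp: bounded_op_UNIV_iff intro: exI[of _ 1])

lemma bounded_op_P_plus: "bounded_op UNIV UNIV P_plus"
  using norm_P_plus_le by (auto simp: bounded_op_UNIV_iff P_plus_add P_plus_scaleC intro!: exI[of _ 1])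

lemma bounded_op_P_minus: "bounded_op UNIV UNIV P_minus"
  unfolding P_minus_eq[abs_def] by (intro bounded_op_diff bounded_op_ident bounded_op_P_plus)

lemma bounded_op_M_z: "bounded_op UNIV UNIV M_z"
  unfolding M_z_def by (intro bounded_op_mult_L2 ess_bounded_id)

section \<open>Multiplication by an inner function and the model space\<close>

locale inner_fun =
  fixes u :: "complex \<Rightarrow> complex"
  assumes inner_u: "inner_function u"
begin

abbreviation U :: "L2 \<Rightarrow> L2" where "U \<equiv> mult_L2 (boundary u)"
abbreviation U_adj :: "L2 \<Rightarrow> L2" where "U_adj \<equiv> mult_L2 (\<lambda>\<zeta>. cnj (boundary u \<zeta>))"

lemma ess_bounded_u [simp, intro]: "ess_bounded (boundary u)"
  by (rule ess_bounded_boundary[OF inner_u])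

lemma ess_bounded_cnj_u [simp, intro]: "ess_bounded (\<lambda>\<zeta>. cnj (boundary u \<zeta>))"
  by (rule ess_bounded_cnj) simp

lemma U_adj_U [simp]: "U_adj (U f) = f"
proof -
  have "AE \<zeta> in circle. cnj (boundary u \<zeta>) * boundary u \<zeta> = 1"
    using inner_function_boundary_AE[OF inner_u]
  proof eventually_elim
    case (elim \<zeta>)
    then show ?case
      using complex_norm_square[of "boundary u \<zeta>"] by (simp add: mult.commute)
  qed
  then have "mult_L2 (\<lambda>\<zeta>. cnj (boundary u \<zeta>) * boundary u \<zeta>) f = mult_L2 (\<lambda>_. 1) f"
    by (intro mult_L2_cong_AE ess_bounded_mult) auto
  then show ?thesis
    by (simp add: mult_L2_mult_L2 mult_L2_const)
qed

lemma cinner_U_left: "cinner (U f) g = cinner f (U_adj g)"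
  by (simp add: cinner_mult_L2_left)

lemma cinner_U_adj_left: "cinner (U_adj f) g = cinner f (U g)"
  by (simp add: cinner_mult_L2_left)

lemma U_pow_L2_in_H2: "n \<ge> 0 \<Longrightarrow> U (pow_L2 n) \<in> H2"
  by (auto simp: H2_def fourier_coeff_mult_boundary_pow_L2[OF inner_u])

text \<open>By duality: the nonnegative coefficients of \<open>U_adj h\<close> are inner products of
  h with \<open>U (pow_L2 n)\<close>, which lies in \<open>H2\<close>. A second use of duality gives
  \<open>U_in_H2\<close>, so no Fourier series has to be multiplied.\<close>

lemma U_adj_in_H2_0_conj:
  assumes "h \<in> H2_0_conj"
  shows "U_adj h \<in> H2_0_conj"
  unfolding H2_0_conj_eq using assms
  by (auto simp: fourier_coeff_eq_cinner cinner_U_adj_left cinner_H2_0_conj_H2 U_pow_L2_in_H2)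

lemma U_in_H2:
  assumes "f \<in> H2"
  shows "U f \<in> H2"
  unfolding H2_def using assms
  by (auto simp: fourier_coeff_eq_cinner cinner_U_left cinner_H2_H2_0_conj U_adj_in_H2_0_conj
      pow_L2_in_H2_0_conj)

text \<open>The nonnegative coefficients of the conjugate of u are conjugates of the moments of
  \<open>boundary u\<close>, so only the mean u(0) survives. This places the candidate for
  \<open>P_model u (pow_L2 0)\<close> in \<open>K_model u\<close>.\<close>

lemma U_adj_one_in_H2_0_conj: "U_adj (pow_L2 0) - cnj (u 0) *\<^sub>C pow_L2 0 \<in> H2_0_conj"
proof -
  have "fourier_coeff (U_adj (pow_L2 0)) n = (if n = 0 then cnj (u 0) else 0)" if "n \<ge> 0" for n
  proof -
    have "fourier_coeff (U_adj (pow_L2 0)) n = cnj (fourier_coeff (U (pow_L2 n)) 0)"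
      by (simp add: fourier_coeff_eq_cinner cinner_U_adj_left cinner_commute[of "pow_L2 0"])
    then show ?thesis
      using that by (simp add: fourier_coeff_mult_boundary_pow_L2[OF inner_u])
  qed
  then show ?thesis
    by (simp add: H2_0_conj_eq fourier_coeff_diff fourier_coeff_scaleC fourier_coeff_pow_L2)
qed

lemma csubspace_K_model: "csubspace_L2 (K_model u)"
  unfolding K_model_def by (intro csubspace_Int csubspace_H2 csubspace_orth_compl)

lemma csubspace_K_perp: "csubspace_L2 (K_perp u)"
  unfolding K_perp_def by (rule csubspace_orth_compl)

text \<open>Moving \<open>U\<close> across the inner product turns orthogonality of f to the image
  of \<open>H2\<close> under \<open>U\<close> into orthogonality of \<open>U_adj f\<close> to
  \<open>H2\<close>.\<close>

lemma in_K_modelI: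
  assumes "f \<in> H2" "U_adj f \<in> H2_0_conj"
  shows "f \<in> K_model u"
proof -
  have "cinner f (U h) = 0" if "h \<in> H2" for h
    using cinner_H2_0_conj_H2[OF assms(2) that] by (simp add: cinner_U_adj_left)
  with assms(1) show ?thesis
    by (auto simp: K_model_def orth_compl_def)
qed

lemma sum_in_K_perp:
  assumes "g \<in> H2_0_conj" "h \<in> H2"
  shows "g + U h \<in> K_perp u"
proof -
  have "cinner (U h) k = 0" if "k \<in> K_model u" for k
    using that assms(2) cinner_commute[of "U h" k] by (auto simp: K_model_def orth_compl_def)
  with assms show ?thesis
    by (auto simp: K_perp_def orth_compl_def cinner_add_left cinner_H2_0_conj_H2 K_model_def)
qed

text \<open>\<open>U \<circ> P_plus \<circ> U_adj\<close> is the projection onto the image of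
  \<open>H2\<close> under \<open>U\<close>; what it leaves of \<open>P_plus f\<close> is the
  candidate for \<open>P_model u f\<close>.\<close>

definition model_part :: "L2 \<Rightarrow> L2" where
  "model_part f = P_plus f - U (P_plus (U_adj (P_plus f)))"

lemma model_part_in_K_model: "model_part f \<in> K_model u"
proof (rule in_K_modelI)
  show "model_part f \<in> H2"
    unfolding model_part_def by (intro csubspace_L2_diff[OF csubspace_H2] U_in_H2 P_plus_in_H2)
  have "U_adj (model_part f) = P_minus (U_adj (P_plus f))"
    by (simp add: model_part_def mult_L2_diff P_minus_eq)
  then show "U_adj (model_part f) \<in> H2_0_conj"
    by simp
qed

lemma diff_model_part: "f - model_part f = P_minus f + U (P_plus (U_adj (P_plus f)))"
  by (simp add: model_part_def P_minus_eq)

lemma P_model_eq: "P_model u f = model_part f"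
  unfolding P_model_def
proof (rule orth_proj_eqI[OF csubspace_K_model model_part_in_K_model])
  show "f - model_part f \<in> orth_compl (K_model u)"
    unfolding diff_model_part K_perp_def[symmetric] by (rule sum_in_K_perp) auto
qed

text \<open>No double orthogonal complement has to be computed: \<open>f - model_part f\<close> has
  the desired form and lies in \<open>K_perp u\<close>, so together with f this puts
  \<open>model_part f\<close> in both \<open>K_model u\<close> and \<open>K_perp u\<close>, and it
  vanishes.\<close>

lemma K_perp_cases:
  assumes "f \<in> K_perp u"
  obtains g h where "g \<in> H2_0_conj" "h \<in> H2" "f = g + U h"
proof -
  have "f - model_part f \<in> K_perp u"
    unfolding diff_model_part by (rule sum_in_K_perp) auto
  then have "f - (f - model_part f) \<in> K_perp u"
    by (rule csubspace_L2_diff[OF csubspace_K_perp assms])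
  then have "cinner (model_part f) (model_part f) = 0"
    using model_part_in_K_model by (auto simp: K_perp_def orth_compl_def)
  then have "f = P_minus f + U (P_plus (U_adj (P_plus f)))"
    using diff_model_part[of f] by simp
  then show ?thesis
    by (intro that[of "P_minus f" "P_plus (U_adj (P_plus f))"]) auto
qed

section \<open>The operator V and its inverse\<close>

lemma V_op_eq: "V_op u f = P_minus f + (1 / cnj (u 0)) *\<^sub>C U_adj (P_plus f)"
  using mult_L2_scaled_left[OF ess_bounded_cnj_u, of "1 / cnj (u 0)"] by (simp add: V_op_def)

lemma V_inv_eq: "V_inv u f = P_minus f + cnj (u 0) *\<^sub>C U (P_plus f)"
  using mult_L2_scaled_left[OF ess_bounded_u, of "cnj (u 0)"] by (simp add: V_inv_def mult.commute)

text \<open>\<open>P_plus\<close> returns \<open>U h\<close> because \<open>U\<close> preserves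
  \<open>H2\<close>, and \<open>U_adj\<close> strips the factor u. In the coordinates (g, h) the
  operator only rescales h, so inverting it is inverting a scalar.\<close>

lemma V_op_sum:
  assumes "g \<in> H2_0_conj" "h \<in> H2"
  shows "V_op u (g + U h) = g + (1 / cnj (u 0)) *\<^sub>C h"
  using assms by (simp add: V_op_eq P_minus_sum P_plus_sum U_in_H2)

lemma V_inv_sum:
  assumes "g \<in> H2_0_conj" "h \<in> H2"
  shows "V_inv u (g + h) = g + U (cnj (u 0) *\<^sub>C h)"
  using assms by (simp add: V_inv_eq P_minus_sum P_plus_sum mult_L2_scaleC)

lemma V_inv_in_K_perp: "V_inv u f \<in> K_perp u"
  unfolding V_inv_eq mult_L2_scaleC[OF ess_bounded_u, symmetric]
  by (intro sum_in_K_perp H2_scaleC) auto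

lemma V_inv_V_op:
  assumes "u 0 \<noteq> 0" "f \<in> K_perp u"
  shows "V_inv u (V_op u f) = f"
  using assms(2)
proof (rule K_perp_cases)
  fix g h assume "g \<in> H2_0_conj" "h \<in> H2" "f = g + U h"
  then show ?thesis
    using assms(1) by (simp add: V_op_sum V_inv_sum H2_scaleC scaleC_scaleC)
qed

lemma V_op_V_inv:
  assumes "u 0 \<noteq> 0"
  shows "V_op u (V_inv u f) = f"
proof -
  have f: "P_minus f + P_plus f = f"
    by (simp add: P_minus_eq)
  have "V_inv u f = P_minus f + U (cnj (u 0) *\<^sub>C P_plus f)"
    using V_inv_sum[of "P_minus f" "P_plus f"] by (simp add: f)
  then have "V_op u (V_inv u f) = P_minus f + (1 / cnj (u 0)) *\<^sub>C cnj (u 0) *\<^sub>C P_plus f"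
    by (simp add: V_op_sum H2_scaleC)
  then show ?thesis
    using assms by (simp add: scaleC_scaleC f)
qed

lemma bounded_op_V_op: "bounded_op UNIV UNIV (V_op u)"
  unfolding V_op_eq[abs_def]
  by (intro bounded_op_add bounded_op_P_minus bounded_op_scaleC
      bounded_op_compose[OF bounded_op_mult_L2 bounded_op_P_plus] ess_bounded_cnj_u)

lemma bounded_op_V_inv: "bounded_op UNIV UNIV (V_inv u)"
  unfolding V_inv_eq[abs_def]
  by (intro bounded_op_add bounded_op_P_minus bounded_op_scaleC
      bounded_op_compose[OF bounded_op_mult_L2 bounded_op_P_plus] ess_bounded_u)

lemma is_inverse_op_V:
  assumes "u 0 \<noteq> 0"
  shows "is_inverse_op (K_perp u) UNIV (V_op u) (V_inv u)"
  unfolding is_inverse_op_def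
  using assms by (auto intro: bounded_op_restrict bounded_op_V_op bounded_op_V_inv
      simp: V_inv_in_K_perp V_inv_V_op V_op_V_inv)

section \<open>The dual of the compressed shift in coordinates\<close>

lemma D_dual_eq: "D_dual u f = P_minus (M_z f) + U (P_plus (U_adj (P_plus (M_z f))))"
  by (simp add: D_dual_def P_model_eq diff_model_part)

lemma bounded_op_D_dual: "bounded_op (K_perp u) (K_perp u) (D_dual u)"
proof (rule bounded_op_restrict)
  show "bounded_op UNIV UNIV (D_dual u)"
    unfolding D_dual_eq[abs_def]
    by (intro bounded_op_add bounded_op_compose[OF bounded_op_P_minus]
        bounded_op_compose[OF bounded_op_mult_L2[OF ess_bounded_u]]
        bounded_op_compose[OF bounded_op_mult_L2[OF ess_bounded_cnj_u]]
        bounded_op_compose[OF bounded_op_P_plus] bounded_op_M_z)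
  show "D_dual u f \<in> K_perp u" for f
    unfolding D_dual_eq by (rule sum_in_K_perp) auto
qed

text \<open>The element \<open>?q\<close> below is \<open>P\<^sub>u 1 = 1 - cnj (u 0) u\<close>.\<close>

lemma D_dual_sum:
  assumes g: "g \<in> H2_0_conj" and h: "h \<in> H2"
  defines "c \<equiv> fourier_coeff g (-1)"
  shows "D_dual u (g + U h) =
    (M_z g - c *\<^sub>C pow_L2 0) + U ((c * cnj (u 0)) *\<^sub>C pow_L2 0 + M_z h)"
proof -
  let ?q = "pow_L2 0 - cnj (u 0) *\<^sub>C U (pow_L2 0)"
  have q: "?q \<in> K_model u"
  proof (rule in_K_modelI)
    show "?q \<in> H2"
      by (intro csubspace_L2_diff[OF csubspace_H2] H2_scaleC U_in_H2 pow_L2_in_H2) auto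
    show "U_adj ?q \<in> H2_0_conj"
      using U_adj_one_in_H2_0_conj by (simp add: mult_L2_diff mult_L2_scaleC)
  qed
  have minus: "M_z g - c *\<^sub>C pow_L2 0 \<in> H2_0_conj"
    unfolding c_def by (rule M_z_diff_in_H2_0_conj[OF g])
  have plus: "(c * cnj (u 0)) *\<^sub>C pow_L2 0 + M_z h \<in> H2"
    by (intro H2_add H2_scaleC pow_L2_in_H2 M_z_in_H2 h) simp
  have "M_z (U h) = U (M_z h)"
    unfolding M_z_def by (simp add: mult_L2_mult_L2 mult.commute)
  \<comment> \<open>Subtracting \<open>c *\<^sub>C ?q\<close> removes the constant from
    \<open>M_z g\<close> and returns it as a multiple of u, so the remainder has the shape required
    by \<open>sum_in_K_perp\<close>.\<close>
  then have diff: "M_z (g + U h) - c *\<^sub>C ?q =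
      (M_z g - c *\<^sub>C pow_L2 0) + U ((c * cnj (u 0)) *\<^sub>C pow_L2 0 + M_z h)"
    by (simp add: M_z_add mult_L2_add mult_L2_scaleC scaleC_diff_right scaleC_scaleC algebra_simps)
  have "P_model u (M_z (g + U h)) = c *\<^sub>C ?q"
    unfolding P_model_def
  proof (rule orth_proj_eqI[OF csubspace_K_model])
    show "c *\<^sub>C ?q \<in> K_model u"
      using q csubspace_K_model by (auto simp: csubspace_L2_def)
    show "M_z (g + U h) - c *\<^sub>C ?q \<in> orth_compl (K_model u)"
      unfolding diff K_perp_def[symmetric] by (rule sum_in_K_perp[OF minus plus])
  qed
  with diff show ?thesis
    by (simp add: D_dual_def)
qed

lemma V_op_D_dual:
  assumes u0: "u 0 \<noteq> 0" and f: "f \<in> K_perp u"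
  shows "V_op u (D_dual u f) = M_z (V_op u f)"
  using f
proof (rule K_perp_cases)
  fix g h assume g: "g \<in> H2_0_conj" and h: "h \<in> H2" and f: "f = g + U h"
  define c where "c = fourier_coeff g (-1)"
  have minus: "M_z g - c *\<^sub>C pow_L2 0 \<in> H2_0_conj"
    unfolding c_def by (rule M_z_diff_in_H2_0_conj[OF g])
  have plus: "(c * cnj (u 0)) *\<^sub>C pow_L2 0 + M_z h \<in> H2"
    by (intro H2_add H2_scaleC pow_L2_in_H2 M_z_in_H2 h) simp
  have "V_op u (D_dual u f) = (M_z g - c *\<^sub>C pow_L2 0) +
      (1 / cnj (u 0)) *\<^sub>C ((c * cnj (u 0)) *\<^sub>C pow_L2 0 + M_z h)"
    unfolding f D_dual_sum[OF g h, folded c_def] by (rule V_op_sum[OF minus plus])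
  also have "\<dots> = M_z g + (1 / cnj (u 0)) *\<^sub>C M_z h"
    using u0 by (simp add: scaleC_add_right scaleC_scaleC)
  also have "\<dots> = M_z (V_op u f)"
    by (simp add: f V_op_sum[OF g h] M_z_add M_z_scaleC)
  finally show ?thesis .
qed

text \<open>\<open>V_inv u\<close> may be applied to the intertwining relation because
  \<open>D_dual u f\<close> stays in \<open>K_perp u\<close>, where \<open>V_inv_V_op\<close>
  holds.\<close>

lemma D_dual_eq_V_inv:
  assumes "u 0 \<noteq> 0" "f \<in> K_perp u"
  shows "D_dual u f = V_inv u (M_z (V_op u f))"
proof -
  have "D_dual u f \<in> K_perp u"
    using bounded_op_D_dual assms by (auto simp: bounded_op_def)
  then show ?thesis
    using assms by (simp flip: V_op_D_dual add: V_inv_V_op)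
qed

end

section \<open>Similarity for two inner functions\<close>

lemma bounded_op_W_op:
  assumes "inner_function u" "inner_function v"
  shows "bounded_op UNIV UNIV (W_op u v)"
  unfolding W_op_def[abs_def]
  by (intro bounded_op_add bounded_op_P_minus bounded_op_scaleC
      bounded_op_compose[OF bounded_op_mult_L2[OF ess_bounded_boundary[OF assms(2)]]]
      bounded_op_compose[OF bounded_op_P_plus]
      bounded_op_mult_L2[OF ess_bounded_cnj[OF ess_bounded_boundary[OF assms(1)]]])

text \<open>\<open>W_op\<close> applies the conjugate of u before \<open>P_plus\<close>,
  \<open>V_op\<close> after it. For f = g + u h both give h, since \<open>U_adj\<close> keeps g in
  \<open>H2_0_conj\<close>; membership in \<open>K_perp u\<close> is what makes the two orders
  agree.\<close>

lemma W_op_eq: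
  assumes "inner_function u" "inner_function v" "f \<in> K_perp u"
  shows "W_op u v f = V_inv v (V_op u f)"
proof -
  interpret u: inner_fun u by standard fact
  interpret v: inner_fun v by standard fact
  from assms(3) show ?thesis
  proof (rule u.K_perp_cases)
    fix g h assume g: "g \<in> H2_0_conj" and h: "h \<in> H2" and f: "f = g + u.U h"
    have "P_plus (u.U_adj f) = h"
      by (simp add: f mult_L2_add P_plus_sum u.U_adj_in_H2_0_conj g h)
    then have "W_op u v f = g + (cnj (v 0) / cnj (u 0)) *\<^sub>C v.U h"
      by (simp add: W_op_def f P_minus_sum g h u.U_in_H2)
    also have "\<dots> = V_inv v (V_op u f)"
      by (simp add: f u.V_op_sum v.V_inv_sum g h H2_scaleC scaleC_scaleC mult_L2_scaleC)
    finally show ?thesis .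
  qed
qed

text \<open>As a composite of one V with the inverse of the other, W is inverted by exchanging u and
  v.\<close>

lemma is_inverse_op_W:
  assumes "inner_function u" "u 0 \<noteq> 0" "inner_function v" "v 0 \<noteq> 0"
  shows "is_inverse_op (K_perp u) (K_perp v) (W_op u v) (W_op v u)"
proof -
  interpret u: inner_fun u by standard fact
  interpret v: inner_fun v by standard fact
  show ?thesis
    unfolding is_inverse_op_def using assms
    by (auto intro!: bounded_op_restrict bounded_op_W_op
        simp: W_op_eq u.V_inv_in_K_perp v.V_inv_in_K_perp
          u.V_op_V_inv v.V_op_V_inv u.V_inv_V_op v.V_inv_V_op)
qed

lemma D_dual_eq_inv_into_W:
  assumes "inner_function u" "u 0 \<noteq> 0" "inner_function v" "v 0 \<noteq> 0" and f: "f \<in> K_perp u"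
  shows "D_dual u f = inv_into (K_perp u) (W_op u v) (D_dual v (W_op u v f))"
proof -
  interpret u: inner_fun u by standard fact
  interpret v: inner_fun v by standard fact
  have D: "D_dual u f \<in> K_perp u"
    using u.bounded_op_D_dual f by (auto simp: bounded_op_def)
  have inj: "inj_on (W_op u v) (K_perp u)"
    using is_inverse_op_W[OF assms(1-4)] by (intro inj_on_inverseI) (auto simp: is_inverse_op_def)
  \<comment> \<open>Both sides equal \<open>V_inv v (M_z (V_op u f))\<close>.\<close>
  have "D_dual v (W_op u v f) = W_op u v (D_dual u f)"
    using assms D
    by (simp add: W_op_eq v.D_dual_eq_V_inv v.V_inv_in_K_perp v.V_op_V_inv u.V_op_D_dual)
  \<comment> \<open>\<open>inv_into\<close> merely picks some preimage; injectivity on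
    \<open>K_perp u\<close> and membership of \<open>D_dual u f\<close> force the choice.\<close>
  then show ?thesis
    using inv_into_f_f[OF inj D] by simp
qed

theorem theorem4p8:
  shows "(\<forall>u. inner_function u \<and> u 0 \<noteq> 0 \<longrightarrow>
            is_inverse_op (K_perp u) UNIV (V_op u) (V_inv u) \<and>
            bounded_op (K_perp u) (K_perp u) (D_dual u) \<and>
            V_op u \<circ> D_dual u \<circ> V_inv u = M_z) \<and>
         (\<forall>u v. inner_function u \<and> u 0 \<noteq> 0 \<and> inner_function v \<and> v 0 \<noteq> 0 \<longrightarrow>
            similar_op (K_perp u) (D_dual u) (K_perp v) (D_dual v) \<and>
            invertible_op (K_perp u) (K_perp v) (W_op u v) \<and>
            (\<forall>f\<in>K_perp u. D_dual u f = inv_into (K_perp u) (W_op u v) (D_dual v (W_op u v f))))"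
proof (intro conjI allI impI; elim conjE)
  fix u assume u: "inner_function u" "u 0 \<noteq> 0"
  then interpret inner_fun u by unfold_locales
  show "is_inverse_op (K_perp u) UNIV (V_op u) (V_inv u)"
    by (rule is_inverse_op_V[OF u(2)])
  show "bounded_op (K_perp u) (K_perp u) (D_dual u)"
    by (rule bounded_op_D_dual)
  show "V_op u \<circ> D_dual u \<circ> V_inv u = M_z"
    by (simp add: fun_eq_iff V_op_D_dual V_inv_in_K_perp V_op_V_inv u(2))
next
  fix u v assume uv: "inner_function u" "u 0 \<noteq> 0" "inner_function v" "v 0 \<noteq> 0"
  show inv: "invertible_op (K_perp u) (K_perp v) (W_op u v)"
    using is_inverse_op_W[OF uv] by (auto simp: invertible_op_def)
  show D: "\<forall>f\<in>K_perp u. D_dual u f = inv_into (K_perp u) (W_op u v) (D_dual v (W_op u v f))"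
    using D_dual_eq_inv_into_W[OF uv] by blast
  show "similar_op (K_perp u) (D_dual u) (K_perp v) (D_dual v)"
    unfolding similar_op_def
    using inv D uv by (auto intro: inner_fun.bounded_op_D_dual inner_fun.intro)
qed

end
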